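(* Let $n\ge1$, let $\mathcal M_n=\mathcal M(\Theta_n,\Theta_n)$ with accessibility $R$, and let $Supp_1,Supp_2\subseteq\mathcal P(\Theta_n)$ be as defined in the context. For $I,J\subseteq\Theta_n$ write $\frac{I,J}{J}$ for the rule $\frac{\bigvee_{\phi\in I\cup J}\phi}{\bigvee_{\phi\in J}\phi}$, and for $x\in\Theta_n$ write $\frac{x,I,J}{x,J}$ for $\frac{\bigvee_{\phi\in\{x\}\cup I\cup J}\phi}{\bigvee_{\phi\in \{x\}\cup J}\phi}$. Then: (1) If $x\in W\in Supp_1$ and $W'=\{w\in W\mid xRw\}$, then $W'\in Supp_1$. (2) If $x\in W\in Supp_1$, $W'=\{w\in W\mid xRw\}$ and $\theta_\diamond(x)=\theta(x)$, then $W'\in Supp_2$. (3) If $x\in W\in Supp_1$, $y\in\Theta_n$ and $\theta_\diamond(x)=\theta_\diamond(y)$, then $W\cup\{y\}\in Supp_1$. (4) If $W_1,W_2\in Supp_1$ then $W_1\cup W_2\in Supp_1$. (5) $W\in Supp_1$ iff $\mathcal M(\Theta_n,W),\phi_j\models\phi_j$ for all $\phi_j\in W$. (6) $W\in Supp_2$ iff (i) $\mathcal M(\Theta_n,W),\phi_j\models\phi_j$ for all $\phi_j\in W$, and (ii) for each subset $D$ of $W$ there exists $\phi_j\in W$ with $\theta_\diamond(\phi_j)=\theta(\phi_j)\cup\bigcup_{\phi\in D}\theta_\diamond(\phi)$. (7) $\frac{I,J}{J}$ is invalid (in some $S4$-model) iff there is $W\in Supp_1$ with $W\cap I\neq\emptyset$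 and $W\subseteq I\cup J$. (8) $\frac{I,J}{J}$ is inadmissible in $S4$ iff there is $W\in Supp_2$ with $W\cap I\neq\emptyset$ and $W\subseteq I\cup J$. (9) If $\frac{I,J}{J}$ is valid (in every $S4$-model) then it is admissible in $S4$. (10) If $\frac{I,J}{J}$ is invalid, then $\frac{x,I,J}{x,J}$ is inadmissible in $S4$ for some $x\in\Theta_n$ with $\theta(x)=\theta_\diamond(x)$. (11) The rules $\frac{I_1,J_1}{J_1},\dots,\frac{I_k,J_k}{J_k}$ are invalid in the same $S4$-model iff there is $W\in Supp_1$ with $W\cap I_i\neq\emptyset$ and $W\subseteq I_i\cup J_i$ for $i=1,\dots,k$. (12) The rules $\frac{I_1,J_1}{J_1},\dots,\frac{I_k,J_k}{J_k}$ are rejected in $S4$ by one and the same substitution $\sigma$ iff there is $W\in Supp_2$ with $W\cap I_i\neq\emptyset$ and $W\subseteq I_i\cup J_i$ for $i=1,\dots,k$. (13) If $\frac{I_1,J_1}{J_1},\dots,\frac{I_k,J_k}{J_k}$ are invalid in the same $S4$-model, then for some $x\in\Theta_n$ with $\theta(x)=\theta_\diamond(x)$ the rules $\frac{x,I_1,J_1}{x,J_1},\dots,\frac{x,I_k,J_k}{x,J_k}$ are rejected in $S4$ by one and the same substitution $\sigma$.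
   Context: $S4$ is the normal modal logic with axioms $K$, $T:\Box A\to A$, $4:\Box A\to\Box\Box A$ and necessitation; $\diamond=\neg\Box\neg$; $S4$-models are Kripke models with reflexive transitive accessibility; a rule $\frac{\alpha}{\beta}$ is valid in a model $\mathcal M$ if $\mathcal M\models\alpha$ (truth at all worlds) implies $\mathcal M\models\beta$. A substitution $\sigma$ rejects $\frac{\alpha}{\beta}$ if $\vdash_{S4}\sigma(\alpha)$ and $\nvdash_{S4}\sigma(\beta)$; a rule is admissible if no substitution rejects it. Fix variables $p_1,\dots,p_n$; $\alpha^1=\alpha$, $\alpha^0=\neg\alpha$. $\Theta_n$ is the set of all disjuncts $\bigwedge_{i=1}^n p_i^{t(i,0)}\wedge\bigwedge_{i=1}^n(\diamond p_i)^{t(i,1)}$, $t:\{1,\dots,n\}\times\{0,1\}\to\{0,1\}$; for such $\phi$, $\theta(\phi)=\{p_i\mid t(i,0)=1\}$, $\theta_\diamond(\phi)=\{p_i\mid t(i,1)=1\}$. For $W\subseteq\Theta_n$, $\mathcal M(\Theta_n,W)$ is the Kripke model with worlds $W$, $\phi R\psi$ iff $\theta_\diamond(\psi)\subseteq\theta_\diamond(\phi)$, and $p_i$ true at $\phi$ iff $p_i\in\theta(\phi)$. A cluster of $\mathcal M_n$ is a set $C\subseteq\Theta_n$ all of whose elements have the same $\theta_\diamond$, denoted $\theta_\diamond(C)$. $Supp_1$ is the smallest subset of $\mathcal P(\Theta_n)$ such that: (a) if $C_1,\dots,C_m$ are clusters and $X_i\subseteq C_i$ with $\bigcup_{x\in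 X_i}\theta(x)=\theta_\diamond(C_i)$ for each $i$, then $\bigcup_{i=1}^m X_i\in Supp_1$; (b) if $W\in Supp_1$ and for $i=1,\dots,l$ we have $Y_i\subseteq W$, clusters $C_i$ and $X_i\subseteq C_i$ with $\theta_\diamond(y)\subseteq\theta_\diamond(C_i)$ for all $y\in Y_i$ and $\theta_\diamond(C_i)=\bigcup_{y\in Y_i}\theta(y)\cup\bigcup_{x\in X_i}\theta(x)$, then $W\cup\bigcup_{i=1}^l X_i\in Supp_1$. $Supp_2$ is the set of $W\in Supp_1$ such that for each $D\subseteq W$ there is $z\in W$ with $\theta_\diamond(z)=\theta(z)\cup\bigcup_{x\in D}\theta_\diamond(x)$.
   Formalization: (3) also assumes θ(y)⊆θ_◇(y); (7), (8), (11), (12) assume I∩J=∅ (each I_i∩J_i=∅); (13) also assumes some x in Θ_n with θ(x)=θ_◇(x) that is not, for any i, the only y in I_i∖J_i with θ(y)=θ_◇(y). As stated these items are false. *)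

theory Defs
  imports Main "HOL-Library.FuncSet"
begin

section \<open>The modal logic S4\<close>

datatype fm = Falsum | Var nat | Imp fm fm | Box fm

definition Neg :: "fm \<Rightarrow> fm" where "Neg A = Imp A Falsum"
definition Verum :: fm where "Verum = Neg Falsum"
definition Disj :: "fm \<Rightarrow> fm \<Rightarrow> fm" where "Disj A B = Imp (Neg A) B"
definition Conj :: "fm \<Rightarrow> fm \<Rightarrow> fm" where "Conj A B = Neg (Imp A (Neg B))"
definition Dia :: "fm \<Rightarrow> fm" where "Dia A = Neg (Box (Neg A))"

text \<open>Boxed formulas count as atoms, so that the tautologies below are exactly the
  substitution instances of propositional tautologies.\<close>

primrec bool_eval :: "(fm \<Rightarrow> bool) \<Rightarrow> fm \<Rightarrow> bool" where
  "bool_eval v Falsum = False"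
| "bool_eval v (Var i) = v (Var i)"
| "bool_eval v (Imp A B) = (bool_eval v A \<longrightarrow> bool_eval v B)"
| "bool_eval v (Box A) = v (Box A)"

definition tautology :: "fm \<Rightarrow> bool" where
  "tautology A \<longleftrightarrow> (\<forall>v. bool_eval v A)"

inductive S4_provable :: "fm \<Rightarrow> bool" where
  Taut: "tautology A \<Longrightarrow> S4_provable A"
| AxK: "S4_provable (Imp (Box (Imp A B)) (Imp (Box A) (Box B)))"
| AxT: "S4_provable (Imp (Box A) A)"
| Ax4: "S4_provable (Imp (Box A) (Box (Box A)))"
| MP: "S4_provable (Imp A B) \<Longrightarrow> S4_provable A \<Longrightarrow> S4_provable B"
| Nec: "S4_provable A \<Longrightarrow> S4_provable (Box A)"

primrec subst :: "(nat \<Rightarrow> fm) \<Rightarrow> fm \<Rightarrow> fm" where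
  "subst \<sigma> Falsum = Falsum"
| "subst \<sigma> (Var i) = \<sigma> i"
| "subst \<sigma> (Imp A B) = Imp (subst \<sigma> A) (subst \<sigma> B)"
| "subst \<sigma> (Box A) = Box (subst \<sigma> A)"

record 'w kripke =
  worlds :: "'w set"
  acc :: "('w \<times> 'w) set"
  val :: "'w \<Rightarrow> nat \<Rightarrow> bool"

primrec sat :: "'w kripke \<Rightarrow> 'w \<Rightarrow> fm \<Rightarrow> bool" where
  "sat M w Falsum = False"
| "sat M w (Var i) = val M w i"
| "sat M w (Imp A B) = (sat M w A \<longrightarrow> sat M w B)"
| "sat M w (Box A) = (\<forall>v. (w, v) \<in> acc M \<longrightarrow> sat M v A)"

definition S4_model :: "'w kripke \<Rightarrow> bool" where
  "S4_model M \<longleftrightarrow> worlds M \<noteq> {} \<and> acc M \<subseteq> worlds M \<times> worlds M \<and>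
     refl_on (worlds M) (acc M) \<and> trans (acc M)"

definition true_in :: "'w kripke \<Rightarrow> fm \<Rightarrow> bool" where
  "true_in M A \<longleftrightarrow> (\<forall>w\<in>worlds M. sat M w A)"


section \<open>Rules\<close>

text \<open>The pair \<open>(\<alpha>, \<beta>)\<close> is the rule with premise \<open>\<alpha>\<close> and conclusion \<open>\<beta>\<close>.\<close>

type_synonym mrule = "fm \<times> fm"

definition valid_in :: "'w kripke \<Rightarrow> mrule \<Rightarrow> bool" where
  "valid_in M r \<longleftrightarrow> (true_in M (fst r) \<longrightarrow> true_in M (snd r))"

definition rejects :: "(nat \<Rightarrow> fm) \<Rightarrow> mrule \<Rightarrow> bool" where
  "rejects \<sigma> r \<longleftrightarrow> S4_provable (subst \<sigma> (fst r)) \<and> \<not> S4_provable (subst \<sigma> (snd r))"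

definition admissible :: "mrule \<Rightarrow> bool" where
  "admissible r \<longleftrightarrow> \<not> (\<exists>\<sigma>. rejects \<sigma> r)"


section \<open>The disjuncts\<close>

definition fm_power :: "fm \<Rightarrow> nat \<Rightarrow> fm" where
  "fm_power A e = (if e = 1 then A else Neg A)"

definition BigConj :: "fm list \<Rightarrow> fm" where
  "BigConj As = foldr Conj As Verum"

definition exponents :: "nat \<Rightarrow> (nat \<times> nat \<Rightarrow> nat) set" where
  "exponents n = ({1..n} \<times> {0, 1}) \<rightarrow>\<^sub>E {0, 1}"

definition disjunct :: "nat \<Rightarrow> (nat \<times> nat \<Rightarrow> nat) \<Rightarrow> fm" where
  "disjunct n t =
     Conj (BigConj (map (\<lambda>i. fm_power (Var i) (t (i, 0))) [1..<Suc n]))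
          (BigConj (map (\<lambda>i. fm_power (Dia (Var i)) (t (i, 1))) [1..<Suc n]))"

definition Theta :: "nat \<Rightarrow> fm set" where
  "Theta n = disjunct n ` exponents n"

text \<open>A set of variables is represented by the set of their indices. The exponents
  \<open>t\<close> are determined by the formula, see \<open>theta_disjunct\<close> and \<open>theta_dia_disjunct\<close>.\<close>

definition theta :: "nat \<Rightarrow> fm \<Rightarrow> nat set" where
  "theta n \<phi> = {i \<in> {1..n}. \<exists>t\<in>exponents n. \<phi> = disjunct n t \<and> t (i, 0) = 1}"

definition theta_dia :: "nat \<Rightarrow> fm \<Rightarrow> nat set" where
  "theta_dia n \<phi> = {i \<in> {1..n}. \<exists>t\<in>exponents n. \<phi> = disjunct n t \<and> t (i, 1) = 1}"

lemma BigConj_map_eq: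
  assumes "BigConj (map f xs) = BigConj (map g xs)" "x \<in> set xs"
  shows "f x = g x"
  using assms by (induction xs) (auto simp: BigConj_def Conj_def Neg_def)

lemma disjunct_eqD:
  assumes "disjunct n t = disjunct n s" "t \<in> exponents n" "s \<in> exponents n" "i \<in> {1..n}"
  shows "t (i, 0) = s (i, 0)" "t (i, 1) = s (i, 1)"
proof -
  have t: "t (i, j) \<in> {0, 1}" if "j \<in> {0, 1}" for j
    using assms(4) that by (intro PiE_mem[OF assms(2)[unfolded exponents_def]]) simp
  have s: "s (i, j) \<in> {0, 1}" if "j \<in> {0, 1}" for j
    using assms(4) that by (intro PiE_mem[OF assms(3)[unfolded exponents_def]]) simp
  have i: "i \<in> set [1..<Suc n]" using assms(4) by auto
  have Conj_inj: "A = A' \<and> B = B'" if "Conj A B = Conj A' B'" for A B A' B'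
    using that by (simp add: Conj_def Neg_def)
  have "fm_power (Var i) (t (i, 0)) = fm_power (Var i) (s (i, 0))"
    using Conj_inj[OF assms(1)[unfolded disjunct_def], THEN conjunct1] i by (rule BigConj_map_eq)
  then show "t (i, 0) = s (i, 0)"
    using t[of 0] s[of 0] by (auto simp: fm_power_def Neg_def split: if_splits)
  have "fm_power (Dia (Var i)) (t (i, 1)) = fm_power (Dia (Var i)) (s (i, 1))"
    using Conj_inj[OF assms(1)[unfolded disjunct_def], THEN conjunct2] i by (rule BigConj_map_eq)
  then show "t (i, 1) = s (i, 1)"
    using t[of 1] s[of 1] by (auto simp: fm_power_def Dia_def Neg_def split: if_splits)
qed

lemma theta_disjunct:
  "t \<in> exponents n \<Longrightarrow> theta n (disjunct n t) = {i \<in> {1..n}. t (i, 0) = 1}"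
  unfolding theta_def using disjunct_eqD(1)[of n t] by (metis (mono_tags, lifting))

lemma theta_dia_disjunct:
  "t \<in> exponents n \<Longrightarrow> theta_dia n (disjunct n t) = {i \<in> {1..n}. t (i, 1) = 1}"
  unfolding theta_dia_def using disjunct_eqD(2)[of n t] by (metis (mono_tags, lifting))

text \<open>The disjunction over a finite set of formulas, taken in some arbitrary order;
  the empty disjunction is \<open>Falsum\<close>.\<close>

definition BigDisj :: "fm set \<Rightarrow> fm" where
  "BigDisj S = foldr Disj (SOME As. set As = S \<and> distinct As) Falsum"

definition rule_IJ :: "fm set \<Rightarrow> fm set \<Rightarrow> mrule" where
  "rule_IJ I J = (BigDisj (I \<union> J), BigDisj J)"

definition rule_xIJ :: "fm \<Rightarrow> fm set \<Rightarrow> fm set \<Rightarrow> mrule" where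
  "rule_xIJ x I J = (BigDisj ({x} \<union> I \<union> J), BigDisj ({x} \<union> J))"


section \<open>Models of disjuncts and the two families of supports\<close>

definition theta_model :: "nat \<Rightarrow> fm set \<Rightarrow> fm kripke" where
  "theta_model n W =
     \<lparr> worlds = W,
       acc = {(\<phi>, \<psi>). \<phi> \<in> W \<and> \<psi> \<in> W \<and> theta_dia n \<psi> \<subseteq> theta_dia n \<phi>},
       val = (\<lambda>\<phi> i. i \<in> theta n \<phi>) \<rparr>"

definition is_cluster :: "nat \<Rightarrow> fm set \<Rightarrow> bool" where
  "is_cluster n C \<longleftrightarrow> C \<subseteq> Theta n \<and> C \<noteq> {} \<and> (\<forall>\<phi>\<in>C. \<forall>\<psi>\<in>C. theta_dia n \<phi> = theta_dia n \<psi>)"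

definition cluster_theta_dia :: "nat \<Rightarrow> fm set \<Rightarrow> nat set" where
  "cluster_theta_dia n C = (THE S. \<forall>\<phi>\<in>C. theta_dia n \<phi> = S)"

inductive_set Supp1 :: "nat \<Rightarrow> fm set set" for n :: nat where
  base: "(\<And>i. i \<in> {1..m::nat} \<Longrightarrow> is_cluster n (C i) \<and> X i \<subseteq> C i \<and>
            (\<Union>x\<in>X i. theta n x) = cluster_theta_dia n (C i)) \<Longrightarrow>
         (\<Union>i\<in>{1..m}. X i) \<in> Supp1 n"
| step: "W \<in> Supp1 n \<Longrightarrow>
         (\<And>i. i \<in> {1..l::nat} \<Longrightarrow> Y i \<subseteq> W \<and> is_cluster n (C i) \<and> X i \<subseteq> C i \<and>
            (\<forall>y\<in>Y i. theta_dia n y \<subseteq> cluster_theta_dia n (C i)) \<and>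
            cluster_theta_dia n (C i) = (\<Union>y\<in>Y i. theta n y) \<union> (\<Union>x\<in>X i. theta n x)) \<Longrightarrow>
         W \<union> (\<Union>i\<in>{1..l}. X i) \<in> Supp1 n"

definition Supp2 :: "nat \<Rightarrow> fm set set" where
  "Supp2 n = {W \<in> Supp1 n. \<forall>D\<subseteq>W. \<exists>z\<in>W. theta_dia n z = theta n z \<union> (\<Union>x\<in>D. theta_dia n x)}"

end

theory Submission
  imports Defs "HOL-Library.Nat_Bijection"
begin

text \<open>In a Kripke model every world satisfies exactly one element of \<open>Theta n\<close>, its type.
  \<open>Supp1 n\<close> consists of the sets of types realized in S4-models, and \<open>Supp2 n\<close> of the sets
  of types of \<open>\<sigma> p\<^sub>1, \<dots>, \<sigma> p\<^sub>n\<close> realized in the canonical model, for some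
  substitution \<open>\<sigma>\<close>; everything else is combinatorics of these two families. That the
  types realized under a substitution satisfy the extra condition of \<open>Supp2 n\<close> follows by adding
  a root below a union of cones. Conversely, given \<open>W\<close> in \<open>Supp2 n\<close>, keep the valuation at worlds
  that only see types in \<open>W\<close>, and settle the remaining worlds step by step: a world that sees the set
  \<open>E\<close> of variables on the settled worlds receives the valuation of a \<open>z \<in> W\<close> with
  \<open>theta_dia n z = theta n z \<union> E\<close>. Only the set \<open>E\<close> of variables matters, and
  treating smaller \<open>E\<close> first makes this process stop after finitely many steps, so that it is
  described by formulas.\<close>

section \<open>Semantics of the disjuncts\<close>

lemma sat_simps [simp]:
  "sat M w (Neg A) \<longleftrightarrow> \<not> sat M w A"
  "sat M w Verum"
  "sat M w (Disj A B) \<longleftrightarrow> sat M w A \<or> sat M w B"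
  "sat M w (Conj A B) \<longleftrightarrow> sat M w A \<and> sat M w B"
  "sat M w (Dia A) \<longleftrightarrow> (\<exists>v. (w, v) \<in> acc M \<and> sat M v A)"
  "sat M w (fm_power A e) \<longleftrightarrow> (e = 1 \<longleftrightarrow> sat M w A)"
  by (auto simp: Neg_def Verum_def Disj_def Conj_def Dia_def fm_power_def)

lemma sat_BigConj [simp]: "sat M w (BigConj As) \<longleftrightarrow> (\<forall>A\<in>set As. sat M w A)"
  by (induction As) (auto simp: BigConj_def)

lemma sat_BigDisj:
  assumes "finite S"
  shows "sat M w (BigDisj S) \<longleftrightarrow> (\<exists>A\<in>S. sat M w A)"
proof -
  have "\<exists>As. set As = S \<and> distinct As"
    using assms by (rule finite_distinct_list)
  from someI_ex[OF this] obtain As where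
    As: "BigDisj S = foldr Disj As Falsum" "set As = S"
    unfolding BigDisj_def by blast
  have "sat M w (foldr Disj As Falsum) \<longleftrightarrow> (\<exists>A\<in>set As. sat M w A)"
    by (induction As) auto
  with As show ?thesis by simp
qed

section \<open>Disjuncts as pairs of sets of variables, and types of worlds\<close>

definition Theta_of :: "nat \<Rightarrow> nat set \<Rightarrow> nat set \<Rightarrow> fm" where
  "Theta_of n A B = disjunct n (\<lambda>x\<in>{1..n} \<times> {0, 1}.
     if (if snd x = 0 then fst x \<in> A else fst x \<in> B) then 1 else 0)"

lemma Theta_of_exponents:
  "(\<lambda>x\<in>{1..n} \<times> {0, 1}. if (if snd x = 0 then fst x \<in> A else fst x \<in> B) then 1 else 0)
     \<in> exponents n"
  by (auto simp: exponents_def PiE_def extensional_def)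

lemma Theta_of_in_Theta [simp]: "Theta_of n A B \<in> Theta n"
  unfolding Theta_of_def Theta_def by (rule imageI[OF Theta_of_exponents])

lemma theta_Theta_of [simp]: "theta n (Theta_of n A B) = A \<inter> {1..n}"
  unfolding Theta_of_def theta_disjunct[OF Theta_of_exponents] by auto

lemma theta_dia_Theta_of [simp]: "theta_dia n (Theta_of n A B) = B \<inter> {1..n}"
  unfolding Theta_of_def theta_dia_disjunct[OF Theta_of_exponents] by auto

text \<open>With the two simplification rules above, disjuncts correspond bijectively to pairs of
  subsets of \<open>{1..n}\<close>.\<close>

lemma Theta_of_theta:
  assumes "\<phi> \<in> Theta n"
  shows "Theta_of n (theta n \<phi>) (theta_dia n \<phi>) = \<phi>"
proof -
  obtain t where t: "t \<in> exponents n" "\<phi> = disjunct n t"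
    using assms unfolding Theta_def by blast
  have "(\<lambda>x\<in>{1..n} \<times> {0, 1}.
     if (if snd x = 0 then fst x \<in> theta n \<phi> else fst x \<in> theta_dia n \<phi>) then 1 else 0) = t"
  proof
    fix x :: "nat \<times> nat"
    have "t x \<in> {0, 1}" if "x \<in> {1..n} \<times> {0, 1}"
      using t(1) that unfolding exponents_def by (rule PiE_mem)
    \<comment> \<open>Elements of \<open>exponents n\<close> are extensional, so both functions also
      agree outside the index square.\<close>
    moreover have "t x = undefined" if "x \<notin> {1..n} \<times> {0, 1}"
      using t(1) that unfolding exponents_def by (rule PiE_arb)
    ultimately show "(\<lambda>x\<in>{1..n} \<times> {0, 1}.
     if (if snd x = 0 then fst x \<in> theta n \<phi> else fst x \<in> theta_dia n \<phi>) then 1 else 0) x = t x"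
      unfolding t(2) theta_disjunct[OF t(1)] theta_dia_disjunct[OF t(1)]
      by (cases x) (auto simp: restrict_def)
  qed
  then show ?thesis
    unfolding Theta_of_def by (rule trans[OF arg_cong[where f = "disjunct n"] t(2)[symmetric]])
qed

lemma Theta_eqI:
  assumes "\<phi> \<in> Theta n" "\<psi> \<in> Theta n" "theta n \<phi> = theta n \<psi>" "theta_dia n \<phi> = theta_dia n \<psi>"
  shows "\<phi> = \<psi>"
  using assms by (metis Theta_of_theta)

lemma theta_subset: "theta n \<phi> \<subseteq> {1..n}" "theta_dia n \<phi> \<subseteq> {1..n}"
  by (auto simp: theta_def theta_dia_def)

lemma finite_Theta [simp]: "finite (Theta n)"
  unfolding Theta_def exponents_def by (intro finite_imageI finite_PiE) auto

definition type_of :: "nat \<Rightarrow> 'w kripke \<Rightarrow> 'w \<Rightarrow> fm" where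
  "type_of n M w = Theta_of n {i. val M w i} {i. \<exists>v. (w, v) \<in> acc M \<and> val M v i}"

lemma type_of_in_Theta [simp]: "type_of n M w \<in> Theta n"
  by (simp add: type_of_def)

lemma theta_type_of: "theta n (type_of n M w) = {i \<in> {1..n}. val M w i}"
  by (auto simp: type_of_def)

lemma theta_dia_type_of:
  "theta_dia n (type_of n M w) = {i \<in> {1..n}. \<exists>v. (w, v) \<in> acc M \<and> val M v i}"
  by (auto simp: type_of_def)

text \<open>The conjuncts decide every variable and every diamond of a variable, and these data
  determine a disjunct. So a world satisfies its type and no other disjunct.\<close>

lemma sat_Theta:
  assumes "\<phi> \<in> Theta n"
  shows "sat M w \<phi> \<longleftrightarrow> \<phi> = type_of n M w"
proof -
  obtain t where t: "t \<in> exponents n" "\<phi> = disjunct n t"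
    using assms unfolding Theta_def by blast
  have ext_iff: "{i \<in> A. P i} = {i \<in> A. Q i} \<longleftrightarrow> (\<forall>i\<in>A. P i \<longleftrightarrow> Q i)" for A :: "nat set" and P Q
    by auto
  have "sat M w \<phi> \<longleftrightarrow> theta n \<phi> = theta n (type_of n M w) \<and> theta_dia n \<phi> = theta_dia n (type_of n M w)"
    unfolding theta_type_of theta_dia_type_of
    unfolding t(2) theta_disjunct[OF t(1)] theta_dia_disjunct[OF t(1)] ext_iff
    by (simp add: disjunct_def atLeastLessThanSuc_atLeastAtMost del: upt_Suc)
  then show ?thesis
    using assms by (auto intro: Theta_eqI)
qed

lemma sat_BigDisj_Theta:
  assumes "S \<subseteq> Theta n"
  shows "sat M w (BigDisj S) \<longleftrightarrow> type_of n M w \<in> S"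
  unfolding sat_BigDisj[OF finite_subset[OF assms finite_Theta]]
proof
  assume "\<exists>A\<in>S. sat M w A"
  then obtain A where A: "A \<in> S" "sat M w A" by blast
  then have "A = type_of n M w" using assms by (intro sat_Theta[THEN iffD1]) auto
  with A(1) show "type_of n M w \<in> S" by simp
next
  have "sat M w (type_of n M w)" by (simp add: sat_Theta[where n = n])
  then show "type_of n M w \<in> S \<Longrightarrow> \<exists>A\<in>S. sat M w A" by blast
qed

definition realized :: "nat \<Rightarrow> 'w kripke \<Rightarrow> fm set" where
  "realized n M = type_of n M ` worlds M"

lemma true_in_BigDisj_Theta:
  assumes "S \<subseteq> Theta n"
  shows "true_in M (BigDisj S) \<longleftrightarrow> realized n M \<subseteq> S"
  using assms by (auto simp: true_in_def realized_def sat_BigDisj_Theta)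

text \<open>The exact failure condition for \<open>W\<close> as set of realized types. When
  \<open>I\<close> and \<open>J\<close> overlap, \<open>W\<close> has to meet \<open>I - J\<close>,
  not merely \<open>I\<close>.\<close>

definition invalidates :: "fm set \<Rightarrow> fm set \<Rightarrow> fm set \<Rightarrow> bool" where
  "invalidates W I J \<longleftrightarrow> W \<subseteq> I \<union> J \<and> \<not> W \<subseteq> J"

lemma invalidates_disjoint:
  assumes "I \<inter> J = {}"
  shows "invalidates W I J \<longleftrightarrow> W \<inter> I \<noteq> {} \<and> W \<subseteq> I \<union> J"
  using assms by (auto simp: invalidates_def)

lemma valid_in_rule_IJ:
  assumes "I \<subseteq> Theta n" "J \<subseteq> Theta n"
  shows "valid_in M (rule_IJ I J) \<longleftrightarrow> \<not> invalidates (realized n M) I J"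
  using assms by (auto simp: valid_in_def rule_IJ_def true_in_BigDisj_Theta invalidates_def)


section \<open>Coherent sets of disjuncts\<close>

text \<open>A local form of \<open>Supp1 n\<close>, free of the inductive generation: the equation
  says that the diamonds asserted by \<phi> are those true at \<phi> in
  \<open>theta_model n W\<close>.\<close>

definition coherent :: "nat \<Rightarrow> fm set \<Rightarrow> bool" where
  "coherent n W \<longleftrightarrow> W \<subseteq> Theta n \<and>
     (\<forall>\<phi>\<in>W. theta_dia n \<phi> = (\<Union>\<psi>\<in>{\<psi>\<in>W. theta_dia n \<psi> \<subseteq> theta_dia n \<phi>}. theta n \<psi>))"

lemma coherentI:
  assumes "W \<subseteq> Theta n"
    and "\<And>\<phi>. \<phi> \<in> W \<Longrightarrow> theta n \<phi> \<subseteq> theta_dia n \<phi>"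
    and "\<And>\<phi> i. \<phi> \<in> W \<Longrightarrow> i \<in> theta_dia n \<phi> \<Longrightarrow>
           \<exists>\<psi>\<in>W. theta_dia n \<psi> \<subseteq> theta_dia n \<phi> \<and> i \<in> theta n \<psi>"
  shows "coherent n W"
  using assms unfolding coherent_def by fast

lemma coherentD:
  assumes "coherent n W"
  shows "W \<subseteq> Theta n"
    and "\<phi> \<in> W \<Longrightarrow> theta n \<phi> \<subseteq> theta_dia n \<phi>"
    and "\<phi> \<in> W \<Longrightarrow> i \<in> theta_dia n \<phi> \<Longrightarrow>
           \<exists>\<psi>\<in>W. theta_dia n \<psi> \<subseteq> theta_dia n \<phi> \<and> i \<in> theta n \<psi>"
proof -
  show "W \<subseteq> Theta n" using assms by (simp add: coherent_def)
  have eq: "theta_dia n \<phi> = (\<Union>\<psi>\<in>{\<psi>\<in>W. theta_dia n \<psi> \<subseteq> theta_dia n \<phi>}. theta n \<psi>)"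
    if "\<phi> \<in> W" for \<phi>
    using assms that by (simp add: coherent_def)
  show "theta n \<phi> \<subseteq> theta_dia n \<phi>" if "\<phi> \<in> W"
    by (subst eq[OF that]) (use that in blast)
  show "\<exists>\<psi>\<in>W. theta_dia n \<psi> \<subseteq> theta_dia n \<phi> \<and> i \<in> theta n \<psi>"
    if "\<phi> \<in> W" "i \<in> theta_dia n \<phi>"
    using that(2) by (subst (asm) eq[OF that(1)]) blast
qed

lemma theta_dia_type_of_theta_model:
  assumes "\<phi> \<in> W"
  shows "theta_dia n (type_of n (theta_model n W) \<phi>) =
    (\<Union>\<psi>\<in>{\<psi>\<in>W. theta_dia n \<psi> \<subseteq> theta_dia n \<phi>}. theta n \<psi>)"
proof -
  have "i \<in> {1..n}" if "i \<in> theta n \<psi>" for i \<psi>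
    using theta_subset(1) that by blast
  then show ?thesis
    unfolding theta_dia_type_of using assms by (auto simp: theta_model_def simp del: atLeastAtMost_iff)
qed

lemma type_of_theta_model:
  assumes "coherent n W" "\<phi> \<in> W"
  shows "type_of n (theta_model n W) \<phi> = \<phi>"
proof (rule Theta_eqI[of _ n])
  note c = coherentD[OF assms(1)]
  show "\<phi> \<in> Theta n" using c(1) assms(2) by blast
  show "theta n (type_of n (theta_model n W) \<phi>) = theta n \<phi>"
    using theta_subset(1)[of n \<phi>] by (auto simp: theta_type_of theta_model_def)
  have "theta_dia n \<phi> = (\<Union>\<psi>\<in>{\<psi>\<in>W. theta_dia n \<psi> \<subseteq> theta_dia n \<phi>}. theta n \<psi>)"
    using assms unfolding coherent_def by blast
  with theta_dia_type_of_theta_model[OF assms(2)]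
  show "theta_dia n (type_of n (theta_model n W) \<phi>) = theta_dia n \<phi>"
    by (rule trans[OF _ sym])
qed simp

lemma S4_model_theta_model: "W \<noteq> {} \<Longrightarrow> S4_model (theta_model n W)"
  by (auto simp: S4_model_def theta_model_def refl_on_def trans_def)

lemma worlds_theta_model [simp]: "worlds (theta_model n W) = W"
  by (simp add: theta_model_def)

lemma realized_theta_model: "coherent n W \<Longrightarrow> realized n (theta_model n W) = W"
  by (simp add: realized_def type_of_theta_model)

text \<open>By \<open>sat_Theta\<close> the right side says that each \<phi> is its own type. The
  \<open>theta\<close> part of this is built into the valuation; the \<open>theta_dia\<close> part
  is coherence.\<close>

lemma coherent_iff_sat:
  assumes "W \<subseteq> Theta n"
  shows "coherent n W \<longleftrightarrow> (\<forall>\<phi>\<in>W. sat (theta_model n W) \<phi> \<phi>)"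
proof
  assume c: "coherent n W"
  show "\<forall>\<phi>\<in>W. sat (theta_model n W) \<phi> \<phi>"
  proof
    fix \<phi> assume "\<phi> \<in> W"
    then have "\<phi> \<in> Theta n" and eq: "type_of n (theta_model n W) \<phi> = \<phi>"
      using assms type_of_theta_model[OF c] by auto
    then show "sat (theta_model n W) \<phi> \<phi>"
      unfolding sat_Theta[OF \<open>\<phi> \<in> Theta n\<close>] by (intro eq[symmetric])
  qed
next
  assume *: "\<forall>\<phi>\<in>W. sat (theta_model n W) \<phi> \<phi>"
  have "theta_dia n \<phi> = (\<Union>\<psi>\<in>{\<psi>\<in>W. theta_dia n \<psi> \<subseteq> theta_dia n \<phi>}. theta n \<psi>)"
    if "\<phi> \<in> W" for \<phi>
  proof -
    have "\<phi> = type_of n (theta_model n W) \<phi>"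
      using * assms that by (intro sat_Theta[THEN iffD1]) auto
    then have "theta_dia n \<phi> = theta_dia n (type_of n (theta_model n W) \<phi>)"
      by (rule arg_cong)
    also have "\<dots> = (\<Union>\<psi>\<in>{\<psi>\<in>W. theta_dia n \<psi> \<subseteq> theta_dia n \<phi>}. theta n \<psi>)"
      using that by (rule theta_dia_type_of_theta_model)
    finally show ?thesis .
  qed
  then show "coherent n W"
    using assms by (simp add: coherent_def)
qed

text \<open>Reflexivity puts \<open>theta\<close> inside \<open>theta_dia\<close>. By transitivity
  \<open>theta_dia\<close> shrinks along accessibility, so the type of a world witnessing a diamond
  is a witness in the sense of coherence.\<close>

lemma coherent_realized:
  assumes "S4_model M"
  shows "coherent n (realized n M)"
proof (rule coherentI)
  show "realized n M \<subseteq> Theta n" by (auto simp: realized_def)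
  fix \<phi> assume "\<phi> \<in> realized n M"
  then obtain w where w: "w \<in> worlds M" "\<phi> = type_of n M w" by (auto simp: realized_def)
  have "(w, w) \<in> acc M" using assms w(1) by (auto simp: S4_model_def refl_on_def)
  then show "theta n \<phi> \<subseteq> theta_dia n \<phi>"
    unfolding w(2) theta_type_of theta_dia_type_of by blast
  fix i assume "i \<in> theta_dia n \<phi>"
  then obtain v where v: "i \<in> {1..n}" "(w, v) \<in> acc M" "val M v i"
    unfolding w(2) theta_dia_type_of by blast
  have "v \<in> worlds M" using assms v(2) by (auto simp: S4_model_def)
  moreover have "theta_dia n (type_of n M v) \<subseteq> theta_dia n \<phi>"
    using assms v(2) unfolding w(2) theta_dia_type_of S4_model_def by (blast dest: transD)
  moreover have "i \<in> theta n (type_of n M v)"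
    using v by (simp add: theta_type_of)
  ultimately show "\<exists>\<psi>\<in>realized n M. theta_dia n \<psi> \<subseteq> theta_dia n \<phi> \<and> i \<in> theta n \<psi>"
    unfolding realized_def by blast
qed

section \<open>Generated sets are the coherent sets\<close>

lemma cluster_theta_dia_eq:
  assumes "is_cluster n C" "x \<in> C"
  shows "cluster_theta_dia n C = theta_dia n x"
  unfolding cluster_theta_dia_def
proof (rule the_equality)
  show "\<forall>\<phi>\<in>C. theta_dia n \<phi> = theta_dia n x"
    using assms unfolding is_cluster_def by blast
qed (use assms(2) in blast)

text \<open>In both rules the variables in \<open>theta_dia\<close> of a new element come from
  \<open>theta\<close> of elements of \<open>X i\<close> or \<open>Y i\<close>, whose
  \<open>theta_dia\<close> is no larger. Old elements keep their witnesses.\<close>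

lemma Supp1_coherent:
  assumes "W \<in> Supp1 n"
  shows "coherent n W"
  using assms
proof induction
  case (base m C X)
  show ?case
  proof (rule coherentI)
    show "(\<Union>i\<in>{1..m}. X i) \<subseteq> Theta n"
    proof (rule UN_least)
      fix i assume "i \<in> {1..m}"
      from base[OF this] show "X i \<subseteq> Theta n" by (auto simp: is_cluster_def)
    qed
    fix x assume "x \<in> (\<Union>i\<in>{1..m}. X i)"
    then obtain i where i: "i \<in> {1..m}" "x \<in> X i" by blast
    have C: "theta_dia n y = (\<Union>x\<in>X i. theta n x)" if "y \<in> X i" for y
    proof -
      have "is_cluster n (C i)" "y \<in> C i" and eq: "(\<Union>x\<in>X i. theta n x) = cluster_theta_dia n (C i)"
        using base[OF i(1)] that by auto
      then show ?thesis using cluster_theta_dia_eq[of n "C i" y] by simp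
    qed
    show "theta n x \<subseteq> theta_dia n x" unfolding C[OF i(2)] using i(2) by blast
    fix k assume "k \<in> theta_dia n x"
    then obtain y where y: "y \<in> X i" "k \<in> theta n y" using C[OF i(2)] by blast
    have "theta_dia n y \<subseteq> theta_dia n x" using C[OF i(2)] C[OF y(1)] by simp
    then show "\<exists>y\<in>(\<Union>i\<in>{1..m}. X i). theta_dia n y \<subseteq> theta_dia n x \<and> k \<in> theta n y"
      using y i(1) by blast
  qed
next
  case (step W l Y C X)
  note W = coherentD[OF step.IH]
  show ?case
  proof (rule coherentI)
    show "W \<union> (\<Union>i\<in>{1..l}. X i) \<subseteq> Theta n"
    proof (intro Un_least UN_least W(1))
      fix i assume "i \<in> {1..l}"
      from step(2)[OF this] show "X i \<subseteq> Theta n" by (auto simp: is_cluster_def)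
    qed
    fix x assume "x \<in> W \<union> (\<Union>i\<in>{1..l}. X i)"
    then consider "x \<in> W" | i where "i \<in> {1..l}" "x \<in> X i" by blast
    then have "theta n x \<subseteq> theta_dia n x \<and> (\<forall>k\<in>theta_dia n x.
      \<exists>y\<in>W \<union> (\<Union>i\<in>{1..l}. X i). theta_dia n y \<subseteq> theta_dia n x \<and> k \<in> theta n y)"
    proof cases
      case 1
      then show ?thesis using W(2)[OF 1] W(3)[OF 1] by (intro conjI ballI) (simp_all add: bex_Un)
    next
      case 2
      \<comment> \<open>The notes split the premise of the rule into its five conjuncts
        \<open>s(1)\<close> to \<open>s(5)\<close>.\<close>
      note s = conjunct1[OF step(2)[OF 2(1)]] conjunct2[OF step(2)[OF 2(1)]]
      note s = s(1) conjunct1[OF s(2)] conjunct2[OF s(2)]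
      note s = s(1,2) conjunct1[OF s(3)] conjunct2[OF s(3)]
      note s = s(1,2,3) conjunct1[OF s(4)] conjunct2[OF s(4)]
      have X: "theta_dia n y = cluster_theta_dia n (C i)" if "y \<in> X i" for y
        using cluster_theta_dia_eq[OF s(2) subsetD[OF s(3) that]] by (rule sym)
      have x: "theta_dia n x = (\<Union>y\<in>Y i. theta n y) \<union> (\<Union>x\<in>X i. theta n x)"
        using X[OF 2(2)] s(5) by (rule trans)
      have Y: "theta_dia n y \<subseteq> theta_dia n x" if "y \<in> Y i" for y
        using s(4) that by (simp add: X[OF 2(2)])
      have "\<exists>y\<in>W \<union> (\<Union>i\<in>{1..l}. X i). theta_dia n y \<subseteq> theta_dia n x \<and> k \<in> theta n y"
        if k: "k \<in> theta_dia n x" for k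
      proof -
        obtain y where y: "k \<in> theta n y" "y \<in> Y i \<or> y \<in> X i" using k x by blast
        have "theta_dia n y \<subseteq> theta_dia n x" if "y \<in> X i" using X[OF that] X[OF 2(2)] by simp
        then have "theta_dia n y \<subseteq> theta_dia n x" using y(2) Y by blast
        moreover have "y \<in> W \<union> (\<Union>i\<in>{1..l}. X i)" using y(2) s(1) 2(1) by blast
        ultimately show ?thesis using y(1) by blast
      qed
      then show ?thesis
      proof (intro conjI ballI)
        show "theta n x \<subseteq> theta_dia n x" unfolding x using 2(2) by blast
      qed
    qed
    note * = conjunct1[OF this] bspec[OF conjunct2[OF this]]
    show "theta n x \<subseteq> theta_dia n x" by (rule *(1))
    fix k assume "k \<in> theta_dia n x"
    then show "\<exists>y\<in>W \<union> (\<Union>i\<in>{1..l}. X i). theta_dia n y \<subseteq> theta_dia n x \<and> k \<in> theta n y"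
      by (rule *(2))
  qed
qed

text \<open>The base rule with \<open>m = 0\<close>, whose premises are vacuous.\<close>

lemma empty_in_Supp1: "{} \<in> Supp1 n"
proof -
  have "(\<Union>i\<in>{1..0::nat}. {}) \<in> Supp1 n"
  proof (rule Supp1.base[of 0 n "\<lambda>_. {}" "\<lambda>_. {}"])
    fix i assume "i \<in> {1..0::nat}"
    then have False by simp
    then show "is_cluster n {} \<and> {} \<subseteq> {} \<and> (\<Union>x\<in>{}. theta n x) = cluster_theta_dia n {}" ..
  qed
  then show ?thesis by simp
qed

text \<open>Induction on \<open>W\<close>: remove the class \<open>X\<close> of an element with
  maximal \<open>theta_dia\<close>. No remaining element has a witness in \<open>X\<close>, so the
  rest is coherent, and one generation step puts \<open>X\<close> back.\<close>

lemma coherent_Supp1: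
  assumes "coherent n W"
  shows "W \<in> Supp1 n"
proof -
  have "finite W"
    using coherentD(1)[OF assms] finite_Theta by (rule finite_subset)
  then show ?thesis using assms
  proof (induction W rule: finite_psubset_induct)
    case (psubset W)
    note W = coherentD[OF psubset.prems]
    show ?case
    proof (cases "W = {}")
      case True
      then show ?thesis by (simp add: empty_in_Supp1)
    next
      case False
      define c where "c \<phi> = card (theta_dia n \<phi>)" for \<phi>
      have "Max (c ` W) \<in> c ` W" using psubset.hyps False by (intro Max_in) auto
      then obtain x where x: "x \<in> W" "Max (c ` W) = c x" by blast
      have c: "c y \<le> c x" if "y \<in> W" for y
        using psubset.hyps that by (simp flip: x(2))
      define X where "X = {y \<in> W. theta_dia n y = theta_dia n x}"
      \<comment> \<open>Maximal cardinality gives maximality for inclusion.\<close>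
      have max: "theta_dia n y = theta_dia n x" if "y \<in> W" "theta_dia n x \<subseteq> theta_dia n y" for y
      proof (rule card_seteq[symmetric, OF _ that(2)])
        show "finite (theta_dia n y)" using theta_subset(2) by (rule finite_subset) simp
        show "card (theta_dia n y) \<le> card (theta_dia n x)" using c[OF that(1)] by (simp add: c_def)
      qed
      have "coherent n (W - X)"
      proof (rule coherentI)
        fix \<phi> i assume "\<phi> \<in> W - X" "i \<in> theta_dia n \<phi>"
        then obtain \<psi> where \<psi>: "\<psi> \<in> W" "theta_dia n \<psi> \<subseteq> theta_dia n \<phi>" "i \<in> theta n \<psi>"
          using W(3)[of \<phi> i] by blast
        \<comment> \<open>A witness in \<open>X\<close> would force
          \<open>theta_dia n x \<subseteq> theta_dia n \<phi>\<close>, hence \<phi> itself into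
          \<open>X\<close>.\<close>
        moreover have "\<psi> \<notin> X"
          using max[of \<phi>] \<psi>(2) \<open>\<phi> \<in> W - X\<close> by (auto simp: X_def)
        ultimately show "\<exists>\<psi>\<in>W - X. theta_dia n \<psi> \<subseteq> theta_dia n \<phi> \<and> i \<in> theta n \<psi>"
          by blast
      qed (use W(1,2) in auto)
      then have "W - X \<in> Supp1 n"
        using psubset.IH[of "W - X"] x X_def by blast
      \<comment> \<open>The case \<open>l = 1\<close>: \<open>X\<close> is taken as its own cluster,
        and \<open>Y\<close> is everything remaining below it.\<close>
      then have "(W - X) \<union> (\<Union>i\<in>{1..1::nat}. X) \<in> Supp1 n"
      proof (rule Supp1.step[where Y = "\<lambda>_. {y \<in> W - X. theta_dia n y \<subseteq> theta_dia n x}" and C = "\<lambda>_. X"])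
        have cl: "is_cluster n X"
          using x W(1) unfolding is_cluster_def X_def by auto
        have eq: "cluster_theta_dia n X = theta_dia n x"
          using x(1) by (intro cluster_theta_dia_eq[OF cl]) (simp add: X_def)
        have "theta_dia n x =
            (\<Union>y\<in>{y \<in> W - X. theta_dia n y \<subseteq> theta_dia n x}. theta n y) \<union> (\<Union>x\<in>X. theta n x)"
          (is "_ = ?A \<union> ?B")
        proof (intro equalityI Un_least UN_least subsetI)
          fix k assume "k \<in> theta_dia n x"
          from W(3)[OF x(1) this] show "k \<in> ?A \<union> ?B" by blast
        next
          fix y k assume "y \<in> {y \<in> W - X. theta_dia n y \<subseteq> theta_dia n x}" "k \<in> theta n y"
          then show "k \<in> theta_dia n x" using W(2)[of y] by blast
        next
          fix y k assume "y \<in> X" "k \<in> theta n y"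
          then have "y \<in> W" "theta_dia n y = theta_dia n x" by (simp_all add: X_def)
          then show "k \<in> theta_dia n x" using W(2)[of y] \<open>k \<in> theta n y\<close> by blast
        qed
        then show "{y \<in> W - X. theta_dia n y \<subseteq> theta_dia n x} \<subseteq> W - X \<and>
          is_cluster n X \<and> X \<subseteq> X \<and>
          (\<forall>y\<in>{y \<in> W - X. theta_dia n y \<subseteq> theta_dia n x}. theta_dia n y \<subseteq> cluster_theta_dia n X) \<and>
          cluster_theta_dia n X =
            (\<Union>y\<in>{y \<in> W - X. theta_dia n y \<subseteq> theta_dia n x}. theta n y) \<union> (\<Union>x\<in>X. theta n x)" for i :: nat
          unfolding eq by (intro conjI cl) blast+
      qed
      moreover have "(W - X) \<union> (\<Union>i\<in>{1..1::nat}. X) = W"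
        by (auto simp: X_def)
      ultimately show ?thesis by simp
    qed
  qed
qed

lemma Supp1_iff: "W \<in> Supp1 n \<longleftrightarrow> coherent n W"
  using Supp1_coherent coherent_Supp1 by blast

section \<open>Closure properties of \<open>Supp1 n\<close> and \<open>Supp2 n\<close>\<close>

lemma Supp1_subset: "W \<in> Supp1 n \<Longrightarrow> W \<subseteq> Theta n"
  by (simp add: Supp1_iff coherentD(1))

text \<open>Witnesses have smaller \<open>theta_dia\<close>, so they never leave the cone.\<close>

lemma Supp1_cone:
  assumes "W \<in> Supp1 n"
  shows "{w \<in> W. theta_dia n w \<subseteq> theta_dia n x} \<in> Supp1 n"
proof -
  note W = coherentD[OF Supp1_coherent[OF assms]]
  have "coherent n {w \<in> W. theta_dia n w \<subseteq> theta_dia n x}"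
  proof (rule coherentI)
    fix \<phi> i assume "\<phi> \<in> {w \<in> W. theta_dia n w \<subseteq> theta_dia n x}" "i \<in> theta_dia n \<phi>"
    then show "\<exists>\<psi>\<in>{w \<in> W. theta_dia n w \<subseteq> theta_dia n x}. theta_dia n \<psi> \<subseteq> theta_dia n \<phi> \<and> i \<in> theta n \<psi>"
      using W(3)[of \<phi> i] by blast
  qed (use W(1,2) in auto)
  then show ?thesis by (simp add: Supp1_iff)
qed

text \<open>The root \<open>x\<close> is the witness for every \<open>D\<close>: all
  \<open>theta_dia\<close> in the cone lie inside \<open>theta n x\<close>.\<close>

lemma Supp2_cone:
  assumes "W \<in> Supp1 n" "x \<in> W" "theta_dia n x = theta n x"
  shows "{w \<in> W. theta_dia n w \<subseteq> theta_dia n x} \<in> Supp2 n"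
  using assms Supp1_cone[OF assms(1)] unfolding Supp2_def by blast

text \<open>The new element takes over the witnesses of \<open>x\<close>.\<close>

lemma Supp1_insert:
  assumes "W \<in> Supp1 n" "x \<in> W" "y \<in> Theta n" "theta_dia n x = theta_dia n y"
    and "theta n y \<subseteq> theta_dia n y"
  shows "W \<union> {y} \<in> Supp1 n"
proof -
  note W = coherentD[OF Supp1_coherent[OF assms(1)]]
  have "coherent n (W \<union> {y})"
  proof (rule coherentI)
    fix \<phi> i assume "\<phi> \<in> W \<union> {y}" "i \<in> theta_dia n \<phi>"
    then show "\<exists>\<psi>\<in>W \<union> {y}. theta_dia n \<psi> \<subseteq> theta_dia n \<phi> \<and> i \<in> theta n \<psi>"
      using W(3)[of \<phi> i] W(3)[of x i] assms(2,4) by auto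
  qed (use W(1,2) assms(3,5) in auto)
  then show ?thesis by (simp add: Supp1_iff)
qed

lemma Supp1_Un:
  assumes "W\<^sub>1 \<in> Supp1 n" "W\<^sub>2 \<in> Supp1 n"
  shows "W\<^sub>1 \<union> W\<^sub>2 \<in> Supp1 n"
proof -
  note W = coherentD[OF Supp1_coherent[OF assms(1)]] coherentD[OF Supp1_coherent[OF assms(2)]]
  have "coherent n (W\<^sub>1 \<union> W\<^sub>2)"
  proof (rule coherentI)
    fix \<phi> i assume "\<phi> \<in> W\<^sub>1 \<union> W\<^sub>2" "i \<in> theta_dia n \<phi>"
    then show "\<exists>\<psi>\<in>W\<^sub>1 \<union> W\<^sub>2. theta_dia n \<psi> \<subseteq> theta_dia n \<phi> \<and> i \<in> theta n \<psi>"
      using W(3,6)[of \<phi> i] by blast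
  qed (use W(1,2,4,5) in \<open>blast+\<close>)
  then show ?thesis by (simp add: Supp1_iff)
qed

lemma Supp1_singleton:
  assumes "x \<in> Theta n" "theta n x = theta_dia n x"
  shows "{x} \<in> Supp1 n"
  using assms by (auto simp: Supp1_iff coherent_def)


section \<open>Invalid rules\<close>

text \<open>\<open>theta_model n W\<close> realizes \<open>W\<close>; as \<open>W\<close> is finite,
  an isomorphic copy of it lives in any infinite type.\<close>

lemma Supp1_realized_in:
  assumes "infinite (UNIV :: 'w set)" "W \<in> Supp1 n" "W \<noteq> {}"
  shows "\<exists>M :: 'w kripke. S4_model M \<and> realized n M = W"
proof -
  have "finite W"
    using assms(2) Supp1_subset finite_Theta finite_subset by blast
  moreover obtain B :: "'w set" where "finite B" "card B = card W"
    using infinite_arbitrarily_large[OF assms(1)] by blast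
  ultimately obtain h where "bij_betw h W B"
    by (metis finite_same_card_bij)
  then have h: "inj_on h W" by (simp add: bij_betw_def)
  define M where "M = \<lparr>worlds = h ` W,
    acc = {(h \<phi>, h \<psi>) | \<phi> \<psi>. \<phi> \<in> W \<and> \<psi> \<in> W \<and> theta_dia n \<psi> \<subseteq> theta_dia n \<phi>},
    val = \<lambda>v i. i \<in> theta n (inv_into W h v)\<rparr>"
  have acc: "(h \<phi>, v) \<in> acc M \<longleftrightarrow> (\<exists>\<psi>\<in>W. v = h \<psi> \<and> theta_dia n \<psi> \<subseteq> theta_dia n \<phi>)" if "\<phi> \<in> W" for \<phi> v
    using that h by (auto simp: M_def inj_on_eq_iff)
  have "S4_model M"
    unfolding S4_model_def
  proof (intro conjI)
    show "refl_on (worlds M) (acc M)"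
      using acc by (auto simp: M_def refl_on_def)
    show "trans (acc M)"
    proof (rule transI)
      fix a b c assume ab: "(a, b) \<in> acc M" and bc: "(b, c) \<in> acc M"
      obtain \<phi> \<psi> where \<phi>: "a = h \<phi>" "\<phi> \<in> W" "\<psi> \<in> W" "b = h \<psi>" "theta_dia n \<psi> \<subseteq> theta_dia n \<phi>"
        using ab by (auto simp: M_def)
      with bc obtain \<chi> where "\<chi> \<in> W" "c = h \<chi>" "theta_dia n \<chi> \<subseteq> theta_dia n \<psi>"
        using acc by blast
      with \<phi> show "(a, c) \<in> acc M" using acc by blast
    qed
  qed (use assms(3) in \<open>auto simp: M_def\<close>)
  moreover have "type_of n M (h \<phi>) = type_of n (theta_model n W) \<phi>" if "\<phi> \<in> W" for \<phi>
  proof -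
    have val: "val M (h \<psi>) i = (i \<in> theta n \<psi>)" if "\<psi> \<in> W" for \<psi> i
      using that h by (simp add: M_def)
    have "(\<exists>v. (h \<phi>, v) \<in> acc M \<and> val M v i) \<longleftrightarrow>
        (\<exists>\<psi>\<in>W. theta_dia n \<psi> \<subseteq> theta_dia n \<phi> \<and> val M (h \<psi>) i)" for i
      unfolding acc[OF that] by blast
    also have "\<dots> i \<longleftrightarrow> (\<exists>v. (\<phi>, v) \<in> acc (theta_model n W) \<and> val (theta_model n W) v i)" for i
      using that val by (auto simp: theta_model_def)
    finally have "(\<exists>v. (h \<phi>, v) \<in> acc M \<and> val M v i) \<longleftrightarrow>
        (\<exists>v. (\<phi>, v) \<in> acc (theta_model n W) \<and> val (theta_model n W) v i)" for i .
    moreover have "val M (h \<phi>) i = val (theta_model n W) \<phi> i" for i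
      using val[OF that] by (simp add: theta_model_def)
    ultimately show ?thesis by (simp add: type_of_def)
  qed
  then have "realized n M = realized n (theta_model n W)"
    by (auto simp: realized_def M_def theta_model_def image_image)
  ultimately show ?thesis
    using realized_theta_model[OF Supp1_coherent[OF assms(2)]] by auto
qed

lemma simultaneously_invalid_iff:
  assumes "infinite (UNIV :: 'w set)" "\<And>i. i \<in> K \<Longrightarrow> I i \<subseteq> Theta n \<and> J i \<subseteq> Theta n"
  shows "(\<exists>M :: 'w kripke. S4_model M \<and> (\<forall>i\<in>K. \<not> valid_in M (rule_IJ (I i) (J i)))) \<longleftrightarrow>
    (\<exists>W\<in>Supp1 n. \<forall>i\<in>K. invalidates W (I i) (J i))"
proof -
  have inv: "(\<forall>i\<in>K. \<not> valid_in M (rule_IJ (I i) (J i))) \<longleftrightarrow>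
      (\<forall>i\<in>K. invalidates (realized n M) (I i) (J i))" for M :: "'w kripke"
    using assms(2) by (intro ball_cong) (simp_all add: valid_in_rule_IJ[where n = n])
  show ?thesis
    unfolding inv
  proof
    assume "\<exists>M :: 'w kripke. S4_model M \<and> (\<forall>i\<in>K. invalidates (realized n M) (I i) (J i))"
    then obtain M :: "'w kripke" where
      "S4_model M" "\<forall>i\<in>K. invalidates (realized n M) (I i) (J i)" by blast
    then show "\<exists>W\<in>Supp1 n. \<forall>i\<in>K. invalidates W (I i) (J i)"
      using coherent_realized[of M n] by (auto simp: Supp1_iff)
  next
    assume "\<exists>W\<in>Supp1 n. \<forall>i\<in>K. invalidates W (I i) (J i)"
    then obtain W where W: "W \<in> Supp1 n" "\<forall>i\<in>K. invalidates W (I i) (J i)" by blast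
    \<comment> \<open>Models have a world, but \<open>Supp1 n\<close> contains the empty set. Empty
      \<open>W\<close> invalidates nothing, so then \<open>K\<close> is empty and a singleton can
      replace \<open>W\<close>.\<close>
    have "\<exists>W\<in>Supp1 n. W \<noteq> {} \<and> (\<forall>i\<in>K. invalidates W (I i) (J i))"
    proof (cases "W = {}")
      case True
      then have "K = {}" using W(2) by (auto simp: invalidates_def)
      moreover have "{Theta_of n {} {}} \<in> Supp1 n" by (intro Supp1_singleton) auto
      ultimately show ?thesis by blast
    qed (use W in blast)
    then obtain W where W: "W \<in> Supp1 n" "W \<noteq> {}" "\<forall>i\<in>K. invalidates W (I i) (J i)" by blast
    then obtain M :: "'w kripke" where "S4_model M" "realized n M = W"
      using Supp1_realized_in[OF assms(1)] by blast
    with W(3) show "\<exists>M :: 'w kripke. S4_model M \<and>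
        (\<forall>i\<in>K. invalidates (realized n M) (I i) (J i))" by blast
  qed
qed


section \<open>Soundness and completeness of S4\<close>

lemma S4_sound:
  assumes "S4_provable A" "S4_model M" "w \<in> worlds M"
  shows "sat M w A"
  using assms(1,3)
proof (induction arbitrary: w)
  case (Taut A)
  \<comment> \<open>Boxed formulas are atoms of \<open>bool_eval\<close>, so truth at a world is one
    of the valuations.\<close>
  have "bool_eval (sat M w) B = sat M w B" for B by (induction B) auto
  with Taut show ?case by (metis tautology_def)
next
  case (AxT A)
  then show ?case using assms(2) by (auto simp: S4_model_def refl_on_def)
next
  case (Ax4 A)
  then show ?case using assms(2) by (auto simp: S4_model_def dest: transD)
next
  case (Nec A)
  then show ?case using assms(2) by (auto simp: S4_model_def)
qed auto

section \<open>Derivability and maximal consistent sets\<close>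

definition derives :: "fm set \<Rightarrow> fm \<Rightarrow> bool" where
  "derives \<Gamma> B \<longleftrightarrow> (\<exists>As. set As \<subseteq> \<Gamma> \<and> S4_provable (foldr Imp As B))"

lemma bool_eval_imps:
  "bool_eval v (foldr Imp As B) \<longleftrightarrow> ((\<forall>A\<in>set As. bool_eval v A) \<longrightarrow> bool_eval v B)"
  by (induction As) auto

lemma derives_Taut: "tautology A \<Longrightarrow> derives \<Gamma> A"
  unfolding derives_def using S4_provable.Taut[of A] by (intro exI[of _ "[]"]) simp

lemma derives_assm: "A \<in> \<Gamma> \<Longrightarrow> derives \<Gamma> A"
  unfolding derives_def
  by (intro exI[of _ "[A]"]) (auto intro: S4_provable.Taut simp: tautology_def)

lemma derives_MP:
  assumes "derives \<Gamma> (Imp A B)" "derives \<Gamma> A"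
  shows "derives \<Gamma> B"
proof -
  obtain As Bs where As: "set As \<subseteq> \<Gamma>" "S4_provable (foldr Imp As (Imp A B))"
    and Bs: "set Bs \<subseteq> \<Gamma>" "S4_provable (foldr Imp Bs A)"
    using assms unfolding derives_def by blast
  have "S4_provable (Imp (foldr Imp As (Imp A B)) (Imp (foldr Imp Bs A) (foldr Imp (As @ Bs) B)))"
    by (rule S4_provable.Taut) (auto simp: tautology_def bool_eval_imps simp del: foldr_append)
  then have "S4_provable (foldr Imp (As @ Bs) B)"
    using As(2) Bs(2) S4_provable.MP by blast
  then show ?thesis
    unfolding derives_def using As(1) Bs(1) by (intro exI[of _ "As @ Bs"]) simp
qed

text \<open>The deduction theorem; it holds because necessitation is applied to theorems only, never
  to assumptions.\<close>

lemma derives_insert: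
  assumes "derives (insert A \<Gamma>) B"
  shows "derives \<Gamma> (Imp A B)"
proof -
  obtain As where As: "set As \<subseteq> insert A \<Gamma>" "S4_provable (foldr Imp As B)"
    using assms unfolding derives_def by blast
  have "S4_provable (Imp (foldr Imp As B) (foldr Imp (removeAll A As) (Imp A B)))"
    by (rule S4_provable.Taut) (auto simp: tautology_def bool_eval_imps)
  then have "S4_provable (foldr Imp (removeAll A As) (Imp A B))"
    using As(2) S4_provable.MP by blast
  then show ?thesis
    unfolding derives_def using As(1) by (intro exI[of _ "removeAll A As"]) auto
qed

lemma derives_by_contradiction:
  assumes "derives (insert (Neg A) \<Gamma>) Falsum"
  shows "derives \<Gamma> A"
proof -
  have "derives \<Gamma> (Imp (Imp (Neg A) Falsum) A)"
    by (rule derives_Taut) (auto simp: tautology_def Neg_def)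
  then show ?thesis
    using derives_insert[OF assms] derives_MP by blast
qed

definition consistent :: "fm set \<Rightarrow> bool" where
  "consistent \<Gamma> \<longleftrightarrow> \<not> derives \<Gamma> Falsum"

definition maximal_consistent :: "fm set \<Rightarrow> bool" where
  "maximal_consistent \<Gamma> \<longleftrightarrow> consistent \<Gamma> \<and> (\<forall>\<Delta>. consistent \<Delta> \<longrightarrow> \<Gamma> \<subseteq> \<Delta> \<longrightarrow> \<Delta> = \<Gamma>)"

text \<open>Zorn's lemma: a derivation of \<open>Falsum\<close> from the union of a chain uses
  finitely many assumptions, which all lie in one member.\<close>

lemma Lindenbaum:
  assumes "consistent \<Gamma>"
  obtains \<Delta> where "maximal_consistent \<Delta>" "\<Gamma> \<subseteq> \<Delta>"
proof -
  define S where "S = {\<Delta>. consistent \<Delta> \<and> \<Gamma> \<subseteq> \<Delta>}"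
  have "\<exists>M\<in>S. \<forall>X\<in>S. M \<subseteq> X \<longrightarrow> X = M"
  proof (rule subset_Zorn_nonempty)
    show "S \<noteq> {}" using assms by (auto simp: S_def)
    fix \<C> assume C: "\<C> \<noteq> {}" "subset.chain S \<C>"
    have "consistent (\<Union>\<C>)"
      unfolding consistent_def derives_def
    proof (intro notI, elim exE conjE)
      fix As assume As: "set As \<subseteq> \<Union>\<C>" "S4_provable (foldr Imp As Falsum)"
      obtain \<Delta> where \<Delta>: "\<Delta> \<in> \<C>" "set As \<subseteq> \<Delta>"
        using finite_subset_Union_chain[OF _ As(1) C] by auto
      then have "derives \<Delta> Falsum"
        using As(2) unfolding derives_def by blast
      then show False
        using C(2) \<Delta>(1) by (auto simp: subset.chain_def S_def consistent_def)
    qed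
    moreover have "\<Gamma> \<subseteq> \<Union>\<C>"
      using C unfolding S_def subset.chain_def by blast
    ultimately show "\<Union>\<C> \<in> S" by (simp add: S_def)
  qed
  then obtain \<Delta> where \<Delta>: "\<Delta> \<in> S" "\<And>X. X \<in> S \<Longrightarrow> \<Delta> \<subseteq> X \<Longrightarrow> X = \<Delta>" by blast
  show thesis
  proof (rule that)
    show "maximal_consistent \<Delta>"
      unfolding maximal_consistent_def
    proof (intro conjI allI impI)
      fix \<Delta>' assume "consistent \<Delta>'" "\<Delta> \<subseteq> \<Delta>'"
      then show "\<Delta>' = \<Delta>" using \<Delta> by (auto simp: S_def)
    qed (use \<Delta>(1) in \<open>simp add: S_def\<close>)
    show "\<Gamma> \<subseteq> \<Delta>" using \<Delta>(1) by (simp add: S_def)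
  qed
qed

context
  fixes \<Gamma> :: "fm set"
  assumes max: "maximal_consistent \<Gamma>"
begin

lemma maximal_consistent_derives: "derives \<Gamma> A \<longleftrightarrow> A \<in> \<Gamma>"
proof
  assume A: "derives \<Gamma> A"
  have "consistent (insert A \<Gamma>)"
    using max derives_MP[OF derives_insert A]
    unfolding maximal_consistent_def consistent_def by blast
  then show "A \<in> \<Gamma>" using max unfolding maximal_consistent_def by blast
qed (rule derives_assm)

lemma maximal_consistent_provable: "S4_provable A \<Longrightarrow> A \<in> \<Gamma>"
  unfolding maximal_consistent_derives[symmetric] derives_def by (intro exI[of _ "[]"]) simp

lemma maximal_consistent_MP: "Imp A B \<in> \<Gamma> \<Longrightarrow> A \<in> \<Gamma> \<Longrightarrow> B \<in> \<Gamma>"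
  using derives_MP maximal_consistent_derives by blast

lemma maximal_consistent_Falsum: "Falsum \<notin> \<Gamma>"
  using max maximal_consistent_derives unfolding maximal_consistent_def consistent_def by blast

lemma maximal_consistent_Neg: "Neg A \<in> \<Gamma> \<longleftrightarrow> A \<notin> \<Gamma>"
proof
  show "Neg A \<in> \<Gamma> \<Longrightarrow> A \<notin> \<Gamma>"
    using maximal_consistent_MP maximal_consistent_Falsum unfolding Neg_def by blast
  assume "A \<notin> \<Gamma>"
  then have "\<not> consistent (insert A \<Gamma>)"
    using max unfolding maximal_consistent_def by blast
  then show "Neg A \<in> \<Gamma>"
    unfolding maximal_consistent_derives[symmetric] consistent_def Neg_def
    using derives_insert by blast
qed

lemma maximal_consistent_Imp: "Imp A B \<in> \<Gamma> \<longleftrightarrow> (A \<in> \<Gamma> \<longrightarrow> B \<in> \<Gamma>)"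
proof
  have "Imp B (Imp A B) \<in> \<Gamma>" "Imp (Neg A) (Imp A B) \<in> \<Gamma>"
    by (intro maximal_consistent_provable S4_provable.Taut; simp add: tautology_def Neg_def)+
  then show "A \<in> \<Gamma> \<longrightarrow> B \<in> \<Gamma> \<Longrightarrow> Imp A B \<in> \<Gamma>"
    using maximal_consistent_MP maximal_consistent_Neg by blast
qed (use maximal_consistent_MP in blast)

end

text \<open>Axiom K iterated over a list of assumptions.\<close>

lemma S4_provable_Box_imps:
  "S4_provable (Imp (Box (foldr Imp Bs A)) (foldr Imp (map Box Bs) (Box A)))"
proof (induction Bs)
  case Nil
  show ?case by (rule S4_provable.Taut) (simp add: tautology_def)
next
  case (Cons B Bs)
  let ?X = "foldr Imp Bs A" and ?Y = "foldr Imp (map Box Bs) (Box A)"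
  have "S4_provable (Imp (Imp (Box (Imp B ?X)) (Imp (Box B) (Box ?X)))
      (Imp (Imp (Box ?X) ?Y) (Imp (Box (Imp B ?X)) (Imp (Box B) ?Y))))"
    by (rule S4_provable.Taut) (simp add: tautology_def)
  from S4_provable.MP[OF S4_provable.MP[OF this S4_provable.AxK] Cons.IH]
  show ?case by simp
qed

lemma derives_Box:
  assumes "derives {B. Box B \<in> \<Gamma>} A"
  shows "derives \<Gamma> (Box A)"
proof -
  obtain Bs where Bs: "set Bs \<subseteq> {B. Box B \<in> \<Gamma>}" "S4_provable (foldr Imp Bs A)"
    using assms unfolding derives_def by blast
  have "S4_provable (foldr Imp (map Box Bs) (Box A))"
    using S4_provable.MP[OF S4_provable_Box_imps S4_provable.Nec[OF Bs(2)]] .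
  then show ?thesis
    unfolding derives_def using Bs(1) by (intro exI[of _ "map Box Bs"]) auto
qed

section \<open>The canonical model\<close>

definition canonical :: "fm set kripke" where
  "canonical = \<lparr>worlds = {\<Gamma>. maximal_consistent \<Gamma>},
     acc = {(\<Gamma>, \<Delta>). maximal_consistent \<Gamma> \<and> maximal_consistent \<Delta> \<and> {B. Box B \<in> \<Gamma>} \<subseteq> \<Delta>},
     val = \<lambda>\<Gamma> i. Var i \<in> \<Gamma>\<rparr>"

text \<open>The truth lemma. If \<open>Box A\<close> is not in \<Gamma>, then by
  \<open>derives_Box\<close> the unboxed formulas of \<Gamma> are consistent with
  \<open>Neg A\<close>, and a maximal extension is a successor refuting \<open>A\<close>.\<close>

lemma sat_canonical: "maximal_consistent \<Gamma> \<Longrightarrow> sat canonical \<Gamma> A \<longleftrightarrow> A \<in> \<Gamma>"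
proof (induction A arbitrary: \<Gamma>)
  case Falsum
  then show ?case by (simp add: maximal_consistent_Falsum)
next
  case (Var i)
  then show ?case by (simp add: canonical_def)
next
  case (Imp A B)
  then show ?case by (simp add: maximal_consistent_Imp)
next
  case (Box A)
  show ?case
  proof
    assume "Box A \<in> \<Gamma>"
    then show "sat canonical \<Gamma> (Box A)"
      using Box.IH by (auto simp: canonical_def)
  next
    assume s: "sat canonical \<Gamma> (Box A)"
    show "Box A \<in> \<Gamma>"
    proof (rule ccontr)
      assume "Box A \<notin> \<Gamma>"
      then have "\<not> derives {B. Box B \<in> \<Gamma>} A"
        using derives_Box maximal_consistent_derives[OF Box.prems] by blast
      then have "consistent (insert (Neg A) {B. Box B \<in> \<Gamma>})"
        unfolding consistent_def using derives_by_contradiction by blast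
      then obtain \<Delta> where \<Delta>: "maximal_consistent \<Delta>" "insert (Neg A) {B. Box B \<in> \<Gamma>} \<subseteq> \<Delta>"
        by (rule Lindenbaum)
      then have "(\<Gamma>, \<Delta>) \<in> acc canonical"
        using Box.prems by (simp add: canonical_def)
      then have "A \<in> \<Delta>" using s Box.IH[OF \<Delta>(1)] by simp
      then show False using \<Delta> maximal_consistent_Neg by blast
    qed
  qed
qed

lemma S4_complete:
  assumes "true_in canonical A"
  shows "S4_provable A"
proof (rule ccontr)
  assume n: "\<not> S4_provable A"
  have "\<not> derives {} A"
    using n by (auto simp: derives_def)
  then have "consistent {Neg A}"
    unfolding consistent_def using derives_by_contradiction by blast
  then obtain \<Delta> where "maximal_consistent \<Delta>" "{Neg A} \<subseteq> \<Delta>"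
    by (rule Lindenbaum)
  then show False
    using assms sat_canonical maximal_consistent_Neg
    by (auto simp: true_in_def canonical_def)
qed

lemma S4_model_canonical: "S4_model canonical"
  unfolding S4_model_def
proof (intro conjI)
  \<comment> \<open>A one-world model shows consistency; completeness then yields a maximal
    consistent set.\<close>
  have "\<not> S4_provable Falsum"
    using S4_sound[of Falsum "theta_model n {A}" A for n A] S4_model_theta_model[of "{A}" n for n A]
    by (auto simp: theta_model_def)
  then show "worlds canonical \<noteq> {}"
    using S4_complete[of Falsum] by (auto simp: true_in_def)
  show "acc canonical \<subseteq> worlds canonical \<times> worlds canonical"
    by (auto simp: canonical_def)
  show "refl_on (worlds canonical) (acc canonical)"
    using maximal_consistent_MP maximal_consistent_provable S4_provable.AxT
    by (force simp: refl_on_def canonical_def)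
  show "trans (acc canonical)"
  proof (rule transI)
    fix \<Gamma> \<Delta> \<Xi> assume *: "(\<Gamma>, \<Delta>) \<in> acc canonical" "(\<Delta>, \<Xi>) \<in> acc canonical"
    then have "maximal_consistent \<Gamma>" by (simp add: canonical_def)
    then have "Box (Box B) \<in> \<Gamma>" if "Box B \<in> \<Gamma>" for B
      using that maximal_consistent_MP maximal_consistent_provable S4_provable.Ax4 by blast
    then show "(\<Gamma>, \<Xi>) \<in> acc canonical"
      using * by (auto simp: canonical_def)
  qed
qed

lemma S4_provable_iff: "S4_provable A \<longleftrightarrow> true_in canonical A"
  using S4_complete S4_sound[OF _ S4_model_canonical] by (auto simp: true_in_def)


section \<open>Substitutions\<close>

text \<open>Moves a substitution from the formula into the valuation.\<close>

definition substituted :: "(nat \<Rightarrow> fm) \<Rightarrow> 'w kripke \<Rightarrow> 'w kripke" where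
  "substituted \<sigma> M = M\<lparr>val := \<lambda>w i. sat M w (\<sigma> i)\<rparr>"

lemma substituted_simps [simp]:
  "worlds (substituted \<sigma> M) = worlds M"
  "acc (substituted \<sigma> M) = acc M"
  "val (substituted \<sigma> M) w i = sat M w (\<sigma> i)"
  "S4_model (substituted \<sigma> M) = S4_model M"
  by (simp_all add: substituted_def S4_model_def)

lemma sat_subst: "sat M w (subst \<sigma> A) \<longleftrightarrow> sat (substituted \<sigma> M) w A"
  by (induction A arbitrary: w) auto

definition spectrum :: "nat \<Rightarrow> (nat \<Rightarrow> fm) \<Rightarrow> fm set" where
  "spectrum n \<sigma> = realized n (substituted \<sigma> canonical)"

lemma rejects_rule_IJ:
  assumes "I \<subseteq> Theta n" "J \<subseteq> Theta n"
  shows "rejects \<sigma> (rule_IJ I J) \<longleftrightarrow> invalidates (spectrum n \<sigma>) I J"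
proof -
  have "S4_provable (subst \<sigma> A) \<longleftrightarrow> true_in (substituted \<sigma> canonical) A" for A
    unfolding S4_provable_iff by (simp add: true_in_def sat_subst)
  then show ?thesis
    using assms
    by (auto simp: rejects_def rule_IJ_def true_in_BigDisj_Theta invalidates_def spectrum_def)
qed

text \<open>The canonical model is universal: if a substituted disjunct holds at a world of some
  S4-model, its negation is unprovable, so some canonical world satisfies it too.\<close>

lemma type_in_spectrum:
  assumes "S4_model M" "w \<in> worlds M"
  shows "type_of n (substituted \<sigma> M) w \<in> spectrum n \<sigma>"
proof -
  let ?z = "type_of n (substituted \<sigma> M) w"
  have "sat M w (subst \<sigma> ?z)"
    by (simp add: sat_subst sat_Theta[where n = n])
  then have "\<not> S4_provable (Neg (subst \<sigma> ?z))"
    using S4_sound[OF _ assms] by force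
  then obtain \<Gamma> where "\<Gamma> \<in> worlds canonical" "sat canonical \<Gamma> (subst \<sigma> ?z)"
    unfolding S4_provable_iff true_in_def by auto
  then show ?thesis
    by (auto simp: sat_subst sat_Theta[where n = n] spectrum_def realized_def)
qed

section \<open>A new root below a union of cones\<close>

definition add_root :: "'w set \<Rightarrow> 'w kripke \<Rightarrow> 'w option kripke" where
  "add_root V M = (let U = {u. \<exists>v\<in>V. (v, u) \<in> acc M} in
     \<lparr>worlds = insert None (Some ` U),
      acc = {None} \<times> insert None (Some ` U) \<union> {(Some u, Some v) | u v. u \<in> U \<and> (u, v) \<in> acc M},
      val = \<lambda>w i. case w of None \<Rightarrow> False | Some u \<Rightarrow> val M u i\<rparr>)"

lemma S4_model_add_root:
  assumes "S4_model M"
  shows "S4_model (add_root V M)"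
proof -
  have t: "(u, v) \<in> acc M \<Longrightarrow> (v, x) \<in> acc M \<Longrightarrow> (u, x) \<in> acc M" for u v x
    using assms unfolding S4_model_def by (blast dest: transD)
  have r: "(u, v) \<in> acc M \<Longrightarrow> (v, v) \<in> acc M" for u v
    using assms unfolding S4_model_def refl_on_def by blast
  show ?thesis
    unfolding S4_model_def
  proof (intro conjI)
    show "trans (acc (add_root V M))"
      by (rule transI) (auto simp: add_root_def Let_def intro: t)
    show "refl_on (worlds (add_root V M)) (acc (add_root V M))"
      by (auto simp: add_root_def Let_def refl_on_def intro: r)
  qed (auto simp: add_root_def Let_def intro: t)
qed

text \<open>The cones are closed under successors by transitivity and the root is above none of
  their worlds, so truth there is unchanged.\<close>

lemma sat_add_root:
  assumes "S4_model M" "v \<in> V" "(v, u) \<in> acc M"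
  shows "sat (add_root V M) (Some u) A \<longleftrightarrow> sat M u A"
  using assms(3)
proof (induction A arbitrary: u)
  case (Box A)
  have "(v, x) \<in> acc M" if "(u, x) \<in> acc M" for x
    using assms(1) that Box.prems unfolding S4_model_def by (blast dest: transD)
  moreover have "(Some u, x) \<in> acc (add_root V M) \<longleftrightarrow> (\<exists>y. x = Some y \<and> (u, y) \<in> acc M)" for x
    using Box.prems assms(2) by (auto simp: add_root_def Let_def)
  ultimately show ?case using Box.IH by auto
qed (auto simp: add_root_def Let_def)

text \<open>The union of the cones of worlds realizing \<open>D\<close> is again part of an S4-model
  after adding a root; the type of that root is the witness required by \<open>Supp2\<close>.\<close>

lemma spectrum_in_Supp2: "spectrum n \<sigma> \<in> Supp2 n"
  unfolding Supp2_def
proof (intro CollectI conjI allI impI)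
  let ?K = "substituted \<sigma> canonical"
  note K = S4_model_canonical
  show "spectrum n \<sigma> \<in> Supp1 n"
    unfolding Supp1_iff spectrum_def using K by (intro coherent_realized) simp
  fix D assume "D \<subseteq> spectrum n \<sigma>"
  then obtain V where V: "V \<subseteq> worlds canonical" "D = type_of n ?K ` V"
    unfolding spectrum_def realized_def by (auto simp: subset_image_iff)
  let ?M = "add_root V canonical"
  let ?z = "type_of n (substituted \<sigma> ?M) None"
  have acc: "(None, x) \<in> acc ?M \<longleftrightarrow> x = None \<or> (\<exists>v\<in>V. \<exists>u. (v, u) \<in> acc canonical \<and> x = Some u)" for x
    by (auto simp: add_root_def Let_def)
  \<comment> \<open>The root sees itself, contributing \<open>theta n ?z\<close>, and the cones of
    \<open>V\<close>, contributing the diamonds of the types in \<open>D\<close>.\<close>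
  have "theta_dia n ?z = theta n ?z \<union> (\<Union>x\<in>D. theta_dia n x)"
    unfolding theta_dia_type_of theta_type_of V(2) substituted_simps acc
    using sat_add_root[OF K, of _ V] by (auto simp: theta_dia_type_of)
  moreover have "?z \<in> spectrum n \<sigma>"
    using S4_model_add_root[OF K] by (rule type_in_spectrum) (simp add: add_root_def Let_def)
  ultimately show "\<exists>z\<in>spectrum n \<sigma>. theta_dia n z = theta n z \<union> (\<Union>x\<in>D. theta_dia n x)"
    by blast
qed


section \<open>The substitution of a set in \<open>Supp2\<close>\<close>

text \<open>The first component of stage \<open>j\<close> defines the worlds that are already settled, the
  second one the substitution on them. Initially the worlds all of whose successors have
  types in \<open>W\<close> are settled. In stage \<open>j\<close> the unsettled worlds that see exactly
  the variables of \<open>set_decode j\<close> on settled worlds receive the valuation \<open>g j\<close>.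
  As \<open>set_decode\<close> enumerates larger sets later, all unsettled worlds above such a world
  see the same variables.\<close>

primrec stage :: "nat \<Rightarrow> fm set \<Rightarrow> (nat \<Rightarrow> nat set) \<Rightarrow> nat \<Rightarrow> fm \<times> (nat \<Rightarrow> fm)" where
  "stage n W g 0 = (Box (BigDisj W), Var)"
| "stage n W g (Suc j) =
     (let u = fst (stage n W g j); s = snd (stage n W g j);
          new = Conj (Neg u) (BigConj (map (\<lambda>i. fm_power (Dia (Conj u (s i)))
                  (if i \<in> set_decode j then 1 else 0)) [1..<Suc n]))
      in (Disj u new, \<lambda>i. Disj (Conj u (s i)) (if i \<in> g j then new else Falsum)))"

definition settled :: "nat \<Rightarrow> fm set \<Rightarrow> (nat \<Rightarrow> nat set) \<Rightarrow> 'w kripke \<Rightarrow> nat \<Rightarrow> 'w \<Rightarrow> bool" where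
  "settled n W g M j w \<longleftrightarrow> sat M w (fst (stage n W g j))"

definition seen :: "nat \<Rightarrow> fm set \<Rightarrow> (nat \<Rightarrow> nat set) \<Rightarrow> 'w kripke \<Rightarrow> nat \<Rightarrow> 'w \<Rightarrow> nat set" where
  "seen n W g M j w = {i \<in> {1..n}. \<exists>v. (w, v) \<in> acc M \<and> settled n W g M j v \<and>
     sat M v (snd (stage n W g j) i)}"

text \<open>\<open>set_decode j\<close> may contain indices outside \<open>{1..n}\<close>, while
  only variables in that range are tested; hence the intersection.\<close>

lemma settled_Suc:
  "settled n W g M (Suc j) w \<longleftrightarrow> settled n W g M j w \<or> seen n W g M j w = set_decode j \<inter> {1..n}"
proof -
  have e: "(if b then 1 else 0 :: nat) = 1 \<longleftrightarrow> b" for b by simp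
  have "set_decode j \<inter> {1..n} = {i \<in> {1..n}. i \<in> set_decode j}" by blast
  then have "seen n W g M j w = set_decode j \<inter> {1..n} \<longleftrightarrow>
      (\<forall>i\<in>{1..n}. i \<in> set_decode j \<longleftrightarrow> (\<exists>v. (w, v) \<in> acc M \<and> settled n W g M j v \<and>
         sat M v (snd (stage n W g j) i)))"
    unfolding seen_def by (simp only:) blast
  moreover have "set [1..<Suc n] = {1..n}" by auto
  ultimately show ?thesis
    unfolding settled_def stage.simps Let_def fst_conv sat_simps sat_BigConj
    by (simp only: set_map ball_simps sat_simps e) blast
qed

lemma sat_stage_Suc:
  "sat M w (snd (stage n W g (Suc j)) i) \<longleftrightarrow>
    (if settled n W g M j w then sat M w (snd (stage n W g j) i)
     else settled n W g M (Suc j) w \<and> i \<in> g j)"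
  unfolding settled_def by (auto simp: Let_def)

lemma set_encode_mono: "finite B \<Longrightarrow> A \<subseteq> B \<Longrightarrow> set_encode A \<le> set_encode B"
  unfolding set_encode_def by (rule sum_mono2) auto

lemma finite_seen: "finite (seen n W g M j w)"
  unfolding seen_def by simp

text \<open>The third conjunct drives the induction: an unsettled world above one being settled sees
  a subset with code at least \<open>j\<close>, hence the same set, and is settled in the same
  stage. This keeps settledness upward closed and makes the new types computable.\<close>

lemma stage_invariant:
  fixes M :: "'w kripke"
  assumes M: "S4_model M" and "W \<subseteq> Theta n"
    and g: "\<And>j D. D \<subseteq> W \<Longrightarrow> set_decode j = (\<Union>x\<in>D. theta_dia n x) \<Longrightarrow>
      \<exists>z\<in>W. theta n z = g j \<and> theta_dia n z = theta n z \<union> set_decode j"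
  shows "(\<forall>w v. settled n W g M j w \<longrightarrow> (w, v) \<in> acc M \<longrightarrow> settled n W g M j v) \<and>
    (\<forall>w\<in>worlds M. settled n W g M j w \<longrightarrow>
       type_of n (substituted (snd (stage n W g j)) M) w \<in> W) \<and>
    (\<forall>w\<in>worlds M. \<not> settled n W g M j w \<longrightarrow> j \<le> set_encode (seen n W g M j w))"
proof (induction j)
  case 0
  have "substituted Var M = M" by (simp add: substituted_def)
  moreover have "(w, w) \<in> acc M" if "w \<in> worlds M" for w
    using M that by (auto simp: S4_model_def refl_on_def)
  moreover have "(w, v) \<in> acc M \<Longrightarrow> (v, x) \<in> acc M \<Longrightarrow> (w, x) \<in> acc M" for w v x
    using M unfolding S4_model_def by (blast dest: transD)
  ultimately show ?case
    unfolding settled_def using assms(2) by (auto simp: sat_BigDisj_Theta)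
next
  case (Suc j)
  let ?U = "settled n W g M j" and ?U' = "settled n W g M (Suc j)"
  let ?s = "snd (stage n W g j)" and ?s' = "snd (stage n W g (Suc j))"
  let ?\<Delta> = "seen n W g M j" and ?\<Delta>' = "seen n W g M (Suc j)"
  have up: "?U w \<Longrightarrow> (w, v) \<in> acc M \<Longrightarrow> ?U v" for w v using Suc.IH by blast
  have ty: "w \<in> worlds M \<Longrightarrow> ?U w \<Longrightarrow> type_of n (substituted ?s M) w \<in> W" for w
    using Suc.IH by blast
  have ge: "w \<in> worlds M \<Longrightarrow> \<not> ?U w \<Longrightarrow> j \<le> set_encode (?\<Delta> w)" for w using Suc.IH by blast
  have acc: "(w, v) \<in> acc M \<Longrightarrow> w \<in> worlds M \<and> v \<in> worlds M" for w v
    using M by (auto simp: S4_model_def)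
  have refl: "w \<in> worlds M \<Longrightarrow> (w, w) \<in> acc M" for w
    using M by (auto simp: S4_model_def refl_on_def)
  have trans: "(w, v) \<in> acc M \<Longrightarrow> (v, x) \<in> acc M \<Longrightarrow> (w, x) \<in> acc M" for w v x
    using M unfolding S4_model_def by (blast dest: transD)
  have mono: "?\<Delta> v \<subseteq> ?\<Delta> w" if "(w, v) \<in> acc M" for w v
    using trans[OF that] unfolding seen_def by blast
  \<comment> \<open>The codes are squeezed: \<open>j \<le> set_encode (?\<Delta> v) \<le> set_encode
    (?\<Delta> w) \<le> j\<close>.\<close>
  have above: "?\<Delta> v = ?\<Delta> w \<and> ?\<Delta> w = set_decode j"
    if "(w, v) \<in> acc M" "?\<Delta> w = set_decode j \<inter> {1..n}" "\<not> ?U v" for w v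
  proof -
    have "j \<le> set_encode (?\<Delta> v)" using ge acc that by blast
    moreover have "set_encode (?\<Delta> v) \<le> set_encode (?\<Delta> w)"
      using mono[OF that(1)] finite_seen by (rule set_encode_mono[rotated])
    moreover have "set_encode (?\<Delta> w) \<le> set_encode (set_decode j)"
      using that(2) by (intro set_encode_mono) auto
    ultimately have "set_encode (?\<Delta> v) = j" "set_encode (?\<Delta> w) = j" by auto
    then show ?thesis using finite_seen set_encode_inverse by metis
  qed
  have up': "?U' v" if "?U' w" "(w, v) \<in> acc M" for w v
    using that up above[OF that(2)] unfolding settled_Suc by metis
  have ty': "type_of n (substituted ?s' M) w \<in> W" if w: "w \<in> worlds M" "?U' w" for w
  proof (cases "?U w")
    case True
    have eq: "sat M v (?s' i) \<longleftrightarrow> sat M v (?s i)" if "(w, v) \<in> acc M" for v i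
      using up[OF True that] by (simp add: sat_stage_Suc del: stage.simps)
    have "(\<exists>v. (w, v) \<in> acc M \<and> sat M v (?s' i)) \<longleftrightarrow>
        (\<exists>v. (w, v) \<in> acc M \<and> sat M v (?s i))" for i
      using eq by blast
    then have "type_of n (substituted ?s' M) w = type_of n (substituted ?s M) w"
      unfolding type_of_def substituted_simps by (simp only: eq[OF refl[OF w(1)]])
    then show ?thesis using ty w True by simp
  next
    case False
    then have eq: "?\<Delta> w = set_decode j \<inter> {1..n}" using w unfolding settled_Suc by blast
    have \<Delta>: "?\<Delta> w = set_decode j" using above[OF refl[OF w(1)] eq False] by blast
    \<comment> \<open>The seen variables are the diamonds of the types of settled worlds above
      \<open>w\<close>, so the hypothesis on \<open>g\<close> applies to this
      \<open>D\<close>.\<close>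
    define D where "D = type_of n (substituted ?s M) ` {v. (w, v) \<in> acc M \<and> ?U v}"
    have "(\<Union>x\<in>D. theta_dia n x) = ?\<Delta> w"
    proof
      show "(\<Union>x\<in>D. theta_dia n x) \<subseteq> ?\<Delta> w"
        using trans up unfolding D_def seen_def by (auto simp: theta_dia_type_of) blast
      show "?\<Delta> w \<subseteq> (\<Union>x\<in>D. theta_dia n x)"
      proof
        fix k assume "k \<in> ?\<Delta> w"
        then obtain v where v: "k \<in> {1..n}" "(w, v) \<in> acc M" "?U v" "sat M v (?s k)"
          unfolding seen_def by blast
        then have "k \<in> theta_dia n (type_of n (substituted ?s M) v)"
          using refl[of v] acc[OF v(2)] unfolding theta_dia_type_of substituted_simps by blast
        then show "k \<in> (\<Union>x\<in>D. theta_dia n x)" using v(2,3) unfolding D_def by blast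
      qed
    qed
    moreover have "D \<subseteq> W" using ty acc unfolding D_def by blast
    ultimately obtain z where z: "z \<in> W" "theta n z = g j" "theta_dia n z = theta n z \<union> ?\<Delta> w"
      using g[of D j] \<Delta> by auto
    have gj: "g j \<subseteq> {1..n}" using z(2) theta_subset(1) by blast
    have "type_of n (substituted ?s' M) w = z"
    proof (rule Theta_eqI[of _ n])
      show "z \<in> Theta n" using z(1) assms(2) by blast
      show "theta n (type_of n (substituted ?s' M) w) = theta n z"
        using gj False w(2) unfolding theta_type_of substituted_simps sat_stage_Suc z(2) by auto
      \<comment> \<open>Newly settled successors contribute only \<open>g j\<close>, and
        \<open>w\<close> itself attains it; the older ones contribute what was seen.\<close>
      have "(\<exists>v. (w, v) \<in> acc M \<and> sat M v (?s' i)) \<longleftrightarrow>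
          i \<in> g j \<or> (\<exists>v. (w, v) \<in> acc M \<and> ?U v \<and> sat M v (?s i))" for i
      proof
        assume "\<exists>v. (w, v) \<in> acc M \<and> sat M v (?s' i)"
        then show "i \<in> g j \<or> (\<exists>v. (w, v) \<in> acc M \<and> ?U v \<and> sat M v (?s i))"
          unfolding sat_stage_Suc by (auto split: if_splits)
      next
        assume "i \<in> g j \<or> (\<exists>v. (w, v) \<in> acc M \<and> ?U v \<and> sat M v (?s i))"
        moreover have "sat M w (?s' i)" if "i \<in> g j"
          unfolding sat_stage_Suc using False w(2) that by simp
        moreover have "sat M v (?s' i)" if "?U v" "sat M v (?s i)" for v
          unfolding sat_stage_Suc using that by simp
        ultimately show "\<exists>v. (w, v) \<in> acc M \<and> sat M v (?s' i)"
          using refl[OF w(1)] by blast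
      qed
      then show "theta_dia n (type_of n (substituted ?s' M) w) = theta_dia n z"
        using gj unfolding theta_dia_type_of substituted_simps z(3) z(2) seen_def by auto
    qed simp
    then show ?thesis using z(1) by simp
  qed
  \<comment> \<open>Seen sets only grow with the stage, and a world whose code is exactly
    \<open>j\<close> is settled now.\<close>
  have ge': "Suc j \<le> set_encode (?\<Delta>' w)" if w: "w \<in> worlds M" "\<not> ?U' w" for w
  proof (rule ccontr)
    assume "\<not> Suc j \<le> set_encode (?\<Delta>' w)"
    moreover have "\<not> ?U w" using w(2) unfolding settled_Suc by blast
    moreover have "?\<Delta> w \<subseteq> ?\<Delta>' w"
      unfolding seen_def sat_stage_Suc settled_Suc by auto
    then have "set_encode (?\<Delta> w) \<le> set_encode (?\<Delta>' w)"
      using finite_seen by (rule set_encode_mono[rotated])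
    ultimately have "set_encode (?\<Delta> w) = j" using ge[OF w(1)] by auto
    then have "?\<Delta> w = set_decode j" using finite_seen set_encode_inverse by metis
    moreover have "?\<Delta> w \<subseteq> {1..n}" unfolding seen_def by blast
    ultimately have "?\<Delta> w = set_decode j \<inter> {1..n}" by blast
    then show False using w(2) unfolding settled_Suc by blast
  qed
  show ?case using up' ty' ge' by blast
qed

text \<open>Everything is settled from stage \<open>0\<close>, so the substitution changes nothing
  on models with all types in \<open>W\<close>. This serves to realize every element of
  \<open>W\<close>.\<close>

lemma stage_identity:
  assumes "true_in M (Box (BigDisj W))" "w \<in> worlds M"
  shows "settled n W g M j w \<and> (\<forall>i. sat M w (snd (stage n W g j) i) \<longleftrightarrow> val M w i)"
proof (induction j)
  case 0
  then show ?case using assms by (simp add: settled_def true_in_def)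
next
  case (Suc j)
  then show ?case by (simp add: sat_stage_Suc settled_Suc del: stage.simps)
qed

text \<open>After enough stages all canonical worlds are settled, so their types lie in
  \<open>W\<close>. Conversely the substitution leaves \<open>theta_model n W\<close> unchanged,
  which realizes all of \<open>W\<close>.\<close>

lemma Supp2_spectrum:
  assumes "W \<in> Supp2 n"
  shows "\<exists>\<sigma>. spectrum n \<sigma> = W"
proof -
  have W1: "W \<in> Supp1 n" and "\<And>D. D \<subseteq> W \<Longrightarrow>
      \<exists>z\<in>W. theta_dia n z = theta n z \<union> (\<Union>x\<in>D. theta_dia n x)"
    using assms by (auto simp: Supp2_def)
  note W2 = this(2)
  have WT: "W \<subseteq> Theta n" using W1 by (rule Supp1_subset)
  \<comment> \<open>The choice is justified when \<open>set_decode j\<close> is a union of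
    \<open>theta_dia\<close> over a subset of \<open>W\<close>.\<close>
  define g where "g j = theta n (SOME z. z \<in> W \<and> theta_dia n z = theta n z \<union> set_decode j)" for j
  have g: "\<exists>z\<in>W. theta n z = g j \<and> theta_dia n z = theta n z \<union> set_decode j"
    if "D \<subseteq> W" "set_decode j = (\<Union>x\<in>D. theta_dia n x)" for j D
  proof -
    have "\<exists>z. z \<in> W \<and> theta_dia n z = theta n z \<union> set_decode j"
      using W2[OF that(1)] that(2) by auto
    from someI_ex[OF this] show ?thesis unfolding g_def by blast
  qed
  \<comment> \<open>One more than the largest possible code of a seen set, so that no world can
    remain unsettled.\<close>
  define N where "N = Suc (set_encode {1..n})"
  define \<sigma> where "\<sigma> = snd (stage n W g N)"
  have "type_of n (substituted \<sigma> canonical) w \<in> W" if "w \<in> worlds canonical" for w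
  proof -
    have "set_encode (seen n W g canonical N w) \<le> set_encode {1..n}"
      by (rule set_encode_mono) (auto simp: seen_def)
    then have "\<not> N \<le> set_encode (seen n W g canonical N w)" by (simp add: N_def)
    moreover note inv = stage_invariant[OF S4_model_canonical WT g, where j = N, THEN conjunct2]
    from bspec[OF conjunct2[OF inv] that]
    have "\<not> settled n W g canonical N w \<longrightarrow> N \<le> set_encode (seen n W g canonical N w)" .
    ultimately have "settled n W g canonical N w" by blast
    with bspec[OF conjunct1[OF inv] that] show ?thesis unfolding \<sigma>_def by (rule mp)
  qed
  then have "spectrum n \<sigma> \<subseteq> W" by (auto simp: spectrum_def realized_def)
  moreover have "W \<subseteq> spectrum n \<sigma>"
  proof
    fix \<phi> assume \<phi>: "\<phi> \<in> W"
    let ?M = "theta_model n W"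
    have W: "worlds ?M = W" by (simp add: theta_model_def)
    have M: "S4_model ?M" using \<phi> by (intro S4_model_theta_model) auto
    have "type_of n ?M v = v" if "v \<in> W" for v
      using Supp1_coherent[OF W1] that by (rule type_of_theta_model)
    then have "true_in ?M (Box (BigDisj W))"
      using M WT by (auto simp: true_in_def W sat_BigDisj_Theta S4_model_def)
    from stage_identity[OF this, of _ n g N]
    have \<sigma>: "sat ?M v (\<sigma> i) \<longleftrightarrow> val ?M v i" if "v \<in> W" for v i
      using that unfolding \<sigma>_def W by blast
    have "(\<exists>v. (\<phi>, v) \<in> acc ?M \<and> sat ?M v (\<sigma> i)) \<longleftrightarrow> (\<exists>v. (\<phi>, v) \<in> acc ?M \<and> val ?M v i)" for i
      using \<sigma> M by (auto simp: S4_model_def W)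
    then have "type_of n (substituted \<sigma> ?M) \<phi> = type_of n ?M \<phi>"
      using \<sigma>[OF \<phi>] by (simp add: type_of_def)
    also have "\<dots> = \<phi>"
      using Supp1_coherent[OF W1] \<phi> by (rule type_of_theta_model)
    finally show "\<phi> \<in> spectrum n \<sigma>"
      using type_in_spectrum[OF M, of \<phi> n \<sigma>] \<phi> W by simp
  qed
  ultimately show ?thesis by blast
qed

text \<open>The spectra of substitutions are exactly the members of \<open>Supp2 n\<close>.\<close>

lemma simultaneously_rejected_iff:
  assumes "\<And>i. i \<in> K \<Longrightarrow> I i \<subseteq> Theta n \<and> J i \<subseteq> Theta n"
  shows "(\<exists>\<sigma>. \<forall>i\<in>K. rejects \<sigma> (rule_IJ (I i) (J i))) \<longleftrightarrow>
    (\<exists>W\<in>Supp2 n. \<forall>i\<in>K. invalidates W (I i) (J i))"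
proof -
  have "(\<exists>\<sigma>. \<forall>i\<in>K. rejects \<sigma> (rule_IJ (I i) (J i))) \<longleftrightarrow>
      (\<exists>\<sigma>. \<forall>i\<in>K. invalidates (spectrum n \<sigma>) (I i) (J i))"
    using assms rejects_rule_IJ by (metis (no_types, lifting))
  then show ?thesis using spectrum_in_Supp2 Supp2_spectrum by metis
qed

lemma inadmissible_iff:
  assumes "I \<subseteq> Theta n" "J \<subseteq> Theta n"
  shows "\<not> admissible (rule_IJ I J) \<longleftrightarrow> (\<exists>W\<in>Supp2 n. invalidates W I J)"
  using simultaneously_rejected_iff[of "{()}" "\<lambda>_. I" n "\<lambda>_. J"] assms
  by (simp add: admissible_def)

lemma invalid_iff:
  assumes "infinite (UNIV :: 'w set)" "I \<subseteq> Theta n" "J \<subseteq> Theta n"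
  shows "(\<exists>M :: 'w kripke. S4_model M \<and> \<not> valid_in M (rule_IJ I J)) \<longleftrightarrow>
    (\<exists>W\<in>Supp1 n. invalidates W I J)"
  using simultaneously_invalid_iff[OF assms(1), of "{()}" "\<lambda>_. I" n "\<lambda>_. J"] assms(2,3) by simp

section \<open>Rules with an added disjunct\<close>

lemma rule_xIJ_eq: "rule_xIJ x I J = rule_IJ I ({x} \<union> J)"
  by (simp add: rule_xIJ_def rule_IJ_def insert_commute)

text \<open>Coherence gives \<open>theta_dia n y = {1..n}\<close>, so \<open>y\<close> is a witness
  for every \<open>D\<close>.\<close>

lemma Supp2_insert:
  assumes "W \<in> Supp1 n" "x \<in> Theta n" "theta n x = theta_dia n x"
    and "y \<in> insert x W" "theta n y = {1..n}"
  shows "insert x W \<in> Supp2 n"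
proof -
  have W: "insert x W \<in> Supp1 n"
    using Supp1_Un[OF Supp1_singleton[OF assms(2,3)] assms(1)] by simp
  have y: "theta_dia n y = {1..n}"
    using coherentD(2)[OF Supp1_coherent[OF W] assms(4)] assms(5) theta_subset(2)[of n y] by auto
  have eq: "theta_dia n y = theta n y \<union> (\<Union>x\<in>D. theta_dia n x)" for D
    using y assms(5) theta_subset(2)[of n] by blast
  show ?thesis
    unfolding Supp2_def by (intro CollectI conjI W allI impI bexI[OF _ assms(4)] eq)
qed

text \<open>The type \<open>f\<close> all of whose variables are true is a root for every set. It can be
  added to \<open>W\<close> unless it already belongs to \<open>W\<close>; in that case any reflexive
  \<open>x\<close> may be added, and \<open>x\<close> only fails if \<open>W \<inter> (I i - J i) = {x}\<close> for some
  \<open>i\<close>. If that happened for every reflexive \<open>x\<close>, then \<open>W\<close> would contain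
  all of them.\<close>

lemma simultaneously_rejected_insert:
  assumes IJ: "\<And>i. i \<in> K \<Longrightarrow> I i \<subseteq> Theta n \<and> J i \<subseteq> Theta n"
    and x0: "x0 \<in> Theta n" "theta n x0 = theta_dia n x0"
    and ne: "\<And>i. i \<in> K \<Longrightarrow> {y \<in> I i - J i. theta n y = theta_dia n y} \<noteq> {x0}"
    and W: "W \<in> Supp1 n" "\<And>i. i \<in> K \<Longrightarrow> invalidates W (I i) (J i)"
  shows "\<exists>x\<in>Theta n. theta n x = theta_dia n x \<and>
    (\<exists>\<sigma>. \<forall>i\<in>K. rejects \<sigma> (rule_xIJ x (I i) (J i)))"
proof -
  define f where "f = Theta_of n {1..n} {1..n}"
  have f: "f \<in> Theta n" "theta n f = {1..n}" "theta n f = theta_dia n f"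
    by (auto simp: f_def)
  \<comment> \<open>Two demands on \<open>x\<close>: \<open>insert x W\<close> contains the full
    type \<open>f\<close>, and \<open>W\<close> still meets each \<open>I i - J i\<close> outside
    \<open>x\<close>, so moving \<open>x\<close> into the conclusion does no harm.\<close>
  have good: "\<exists>x. x \<in> Theta n \<and> theta n x = theta_dia n x \<and> (x = f \<or> f \<in> W) \<and>
      (\<forall>i\<in>K. \<not> W \<inter> (I i - J i) \<subseteq> {x})"
  proof (cases "f \<in> W")
    case False
    have "\<not> W \<inter> (I i - J i) \<subseteq> {f}" if "i \<in> K" for i
      using W(2)[OF that] False unfolding invalidates_def by blast
    then show ?thesis using f by blast
  next
    case True
    show ?thesis
    proof (rule ccontr)
      assume "\<not> ?thesis"
      then have bad: "\<exists>i\<in>K. W \<inter> (I i - J i) \<subseteq> {x}" if "x \<in> Theta n" "theta n x = theta_dia n x" for x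
        using True that by blast
      have mem: "W \<inter> (I i - J i) = {x}" if "i \<in> K" "W \<inter> (I i - J i) \<subseteq> {x}" for i x
        using W(2)[OF that(1)] that(2) unfolding invalidates_def by blast
      have all: "x \<in> W" if "x \<in> Theta n" "theta n x = theta_dia n x" for x
        using bad[OF that] mem by blast
      obtain i where i: "i \<in> K" "W \<inter> (I i - J i) = {x0}" using bad[OF x0] mem by blast
      \<comment> \<open>All reflexive types lie in \<open>W\<close>, so those in
        \<open>I i - J i\<close> lie in the intersection \<open>{x0}\<close>.\<close>
      have "{y \<in> I i - J i. theta n y = theta_dia n y} = {x0}"
        using i(2) x0(2) all IJ[OF i(1)] by blast
      then show False using ne[OF i(1)] by blast
    qed
  qed
  then obtain x where x: "x \<in> Theta n" "theta n x = theta_dia n x" "x = f \<or> f \<in> W"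
    "\<And>i. i \<in> K \<Longrightarrow> \<not> W \<inter> (I i - J i) \<subseteq> {x}" by blast
  have "insert x W \<in> Supp2 n"
    using Supp2_insert[OF W(1) x(1,2), of f] x(3) f(2) by blast
  moreover have "invalidates (insert x W) (I i) ({x} \<union> J i)" if "i \<in> K" for i
    using W(2)[OF that] x(4)[OF that] unfolding invalidates_def by blast
  ultimately have "\<exists>\<sigma>. \<forall>i\<in>K. rejects \<sigma> (rule_IJ (I i) ({x} \<union> J i))"
    using IJ x(1) by (subst simultaneously_rejected_iff[where n = n]) auto
  then show ?thesis using x(1,2) unfolding rule_xIJ_eq by blast
qed

text \<open>As \<open>n \<ge> 1\<close>, the empty and the full reflexive type differ. The reflexive
  part of \<open>I - J\<close> cannot be the singleton of both, so one of them can serve as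
  \<open>x0\<close>.\<close>

lemma invalid_imp_inadmissible_insert:
  assumes "n \<ge> 1" "I \<subseteq> Theta n" "J \<subseteq> Theta n" "W \<in> Supp1 n" "invalidates W I J"
  shows "\<exists>x\<in>Theta n. theta n x = theta_dia n x \<and> \<not> admissible (rule_xIJ x I J)"
proof -
  let ?R = "{y \<in> I - J. theta n y = theta_dia n y}"
  let ?x = "Theta_of n {} {}" and ?y = "Theta_of n {1..n} {1..n}"
  have "theta n ?x \<noteq> theta n ?y" using assms(1) by auto
  then have "?x \<noteq> ?y" by metis
  then have "?R \<noteq> {?x} \<or> ?R \<noteq> {?y}" by auto
  moreover have ?thesis if x: "x \<in> Theta n" "theta n x = theta_dia n x" "?R \<noteq> {x}" for x
    using simultaneously_rejected_insert[of "{()}" "\<lambda>_. I" n "\<lambda>_. J" x W] assms(2-) x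
    by (simp add: admissible_def)
  from this[of ?x] this[of ?y] have "?R \<noteq> {?x} \<Longrightarrow> ?thesis" "?R \<noteq> {?y} \<Longrightarrow> ?thesis"
    by simp_all
  ultimately show ?thesis by (rule disjE)
qed

section \<open>The thirteen claims collected\<close>

theorem theorem3p10:
  fixes n :: nat
  assumes "n \<ge> 1"
    and "infinite (UNIV :: 'w set)" \<comment> \<open>the worlds of the models below are arbitrary subsets of \<open>'w\<close>\<close>
  shows
    \<comment> \<open>(1)\<close>
    "(\<forall>W x. W \<in> Supp1 n \<and> x \<in> W \<longrightarrow>
        {w \<in> W. (x, w) \<in> acc (theta_model n (Theta n))} \<in> Supp1 n)
     \<and> \<comment> \<open>(2)\<close>
     (\<forall>W x. W \<in> Supp1 n \<and> x \<in> W \<and> theta_dia n x = theta n x \<longrightarrow>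
        {w \<in> W. (x, w) \<in> acc (theta_model n (Theta n))} \<in> Supp2 n)
     \<and> \<comment> \<open>(3); without \<open>theta n y \<subseteq> theta_dia n y\<close> the formula \<open>y\<close> is unsatisfiable
           and the claim fails\<close>
     (\<forall>W x. \<forall>y\<in>Theta n. W \<in> Supp1 n \<and> x \<in> W \<and> theta_dia n x = theta_dia n y \<and>
        theta n y \<subseteq> theta_dia n y \<longrightarrow> W \<union> {y} \<in> Supp1 n)
     \<and> \<comment> \<open>(4)\<close>
     (\<forall>W\<^sub>1 W\<^sub>2. W\<^sub>1 \<in> Supp1 n \<and> W\<^sub>2 \<in> Supp1 n \<longrightarrow> W\<^sub>1 \<union> W\<^sub>2 \<in> Supp1 n)
     \<and> \<comment> \<open>(5)\<close>
     (\<forall>W\<subseteq>Theta n. W \<in> Supp1 n \<longleftrightarrow> (\<forall>\<phi>\<in>W. sat (theta_model n W) \<phi> \<phi>))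
     \<and> \<comment> \<open>(6)\<close>
     (\<forall>W\<subseteq>Theta n. W \<in> Supp2 n \<longleftrightarrow>
        (\<forall>\<phi>\<in>W. sat (theta_model n W) \<phi> \<phi>) \<and>
        (\<forall>D\<subseteq>W. \<exists>\<phi>\<in>W. theta_dia n \<phi> = theta n \<phi> \<union> (\<Union>\<psi>\<in>D. theta_dia n \<psi>)))
     \<and> \<comment> \<open>(7); \<open>I\<close> and \<open>J\<close> are disjoint: for \<open>I = J = W\<close> the rule is valid in every model,
           but \<open>W\<close> may lie in \<open>Supp1 n\<close>. Likewise in (8), (11), (12)\<close>
     (\<forall>I J. I \<subseteq> Theta n \<and> J \<subseteq> Theta n \<and> I \<inter> J = {} \<longrightarrow>
        ((\<exists>M :: 'w kripke. S4_model M \<and> \<not> valid_in M (rule_IJ I J)) \<longleftrightarrow>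
         (\<exists>W\<in>Supp1 n. W \<inter> I \<noteq> {} \<and> W \<subseteq> I \<union> J)))
     \<and> \<comment> \<open>(8)\<close>
     (\<forall>I J. I \<subseteq> Theta n \<and> J \<subseteq> Theta n \<and> I \<inter> J = {} \<longrightarrow>
        (\<not> admissible (rule_IJ I J) \<longleftrightarrow>
         (\<exists>W\<in>Supp2 n. W \<inter> I \<noteq> {} \<and> W \<subseteq> I \<union> J)))
     \<and> \<comment> \<open>(9)\<close>
     (\<forall>I J. I \<subseteq> Theta n \<and> J \<subseteq> Theta n \<longrightarrow>
        (\<forall>M :: 'w kripke. S4_model M \<longrightarrow> valid_in M (rule_IJ I J)) \<longrightarrow>
        admissible (rule_IJ I J))
     \<and> \<comment> \<open>(10)\<close>
     (\<forall>I J. I \<subseteq> Theta n \<and> J \<subseteq> Theta n \<longrightarrow>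
        (\<exists>M :: 'w kripke. S4_model M \<and> \<not> valid_in M (rule_IJ I J)) \<longrightarrow>
        (\<exists>x\<in>Theta n. theta n x = theta_dia n x \<and> \<not> admissible (rule_xIJ x I J)))
     \<and> \<comment> \<open>(11)\<close>
     (\<forall>(k::nat) I J. (\<forall>i\<in>{1..k}. I i \<subseteq> Theta n \<and> J i \<subseteq> Theta n \<and> I i \<inter> J i = {}) \<longrightarrow>
        ((\<exists>M :: 'w kripke. S4_model M \<and> (\<forall>i\<in>{1..k}. \<not> valid_in M (rule_IJ (I i) (J i)))) \<longleftrightarrow>
         (\<exists>W\<in>Supp1 n. \<forall>i\<in>{1..k}. W \<inter> I i \<noteq> {} \<and> W \<subseteq> I i \<union> J i)))
     \<and> \<comment> \<open>(12)\<close>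
     (\<forall>(k::nat) I J. (\<forall>i\<in>{1..k}. I i \<subseteq> Theta n \<and> J i \<subseteq> Theta n \<and> I i \<inter> J i = {}) \<longrightarrow>
        ((\<exists>\<sigma>. \<forall>i\<in>{1..k}. rejects \<sigma> (rule_IJ (I i) (J i))) \<longleftrightarrow>
         (\<exists>W\<in>Supp2 n. \<forall>i\<in>{1..k}. W \<inter> I i \<noteq> {} \<and> W \<subseteq> I i \<union> J i)))
     \<and> \<comment> \<open>(13); the second hypothesis holds in particular if \<open>k < 2 ^ n\<close>, or if some \<open>x\<close> with
           \<open>theta n x = theta_dia n x\<close> lies in none of the \<open>I i\<close>\<close>
     (\<forall>(k::nat) I J. (\<forall>i\<in>{1..k}. I i \<subseteq> Theta n \<and> J i \<subseteq> Theta n) \<and>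
        (\<exists>x\<in>Theta n. theta n x = theta_dia n x \<and>
           (\<forall>i\<in>{1..k}. {y \<in> I i - J i. theta n y = theta_dia n y} \<noteq> {x})) \<longrightarrow>
        (\<exists>M :: 'w kripke. S4_model M \<and> (\<forall>i\<in>{1..k}. \<not> valid_in M (rule_IJ (I i) (J i)))) \<longrightarrow>
        (\<exists>x\<in>Theta n. theta n x = theta_dia n x \<and>
           (\<exists>\<sigma>. \<forall>i\<in>{1..k}. rejects \<sigma> (rule_xIJ x (I i) (J i)))))"
proof (intro conjI)
  have cone: "{w \<in> W. (x, w) \<in> acc (theta_model n (Theta n))} =
      {w \<in> W. theta_dia n w \<subseteq> theta_dia n x}" if "W \<in> Supp1 n" "x \<in> W" for W x
    using that Supp1_subset by (auto simp: theta_model_def)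
  show "\<forall>W x. W \<in> Supp1 n \<and> x \<in> W \<longrightarrow>
      {w \<in> W. (x, w) \<in> acc (theta_model n (Theta n))} \<in> Supp1 n"
    by (simp add: cone Supp1_cone)
  show "\<forall>W x. W \<in> Supp1 n \<and> x \<in> W \<and> theta_dia n x = theta n x \<longrightarrow>
      {w \<in> W. (x, w) \<in> acc (theta_model n (Theta n))} \<in> Supp2 n"
  proof (intro allI impI, elim conjE)
    fix W x assume W: "W \<in> Supp1 n" "x \<in> W" "theta_dia n x = theta n x"
    then show "{w \<in> W. (x, w) \<in> acc (theta_model n (Theta n))} \<in> Supp2 n"
      unfolding cone[OF W(1,2)] by (rule Supp2_cone)
  qed
  show "\<forall>W x. \<forall>y\<in>Theta n. W \<in> Supp1 n \<and> x \<in> W \<and> theta_dia n x = theta_dia n y \<and>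
      theta n y \<subseteq> theta_dia n y \<longrightarrow> W \<union> {y} \<in> Supp1 n"
    using Supp1_insert by blast
  show "\<forall>W\<^sub>1 W\<^sub>2. W\<^sub>1 \<in> Supp1 n \<and> W\<^sub>2 \<in> Supp1 n \<longrightarrow> W\<^sub>1 \<union> W\<^sub>2 \<in> Supp1 n"
    using Supp1_Un by blast
  show 5: "\<forall>W\<subseteq>Theta n. W \<in> Supp1 n \<longleftrightarrow> (\<forall>\<phi>\<in>W. sat (theta_model n W) \<phi> \<phi>)"
    by (simp add: Supp1_iff coherent_iff_sat)
  show "\<forall>W\<subseteq>Theta n. W \<in> Supp2 n \<longleftrightarrow>
      (\<forall>\<phi>\<in>W. sat (theta_model n W) \<phi> \<phi>) \<and>
      (\<forall>D\<subseteq>W. \<exists>\<phi>\<in>W. theta_dia n \<phi> = theta n \<phi> \<union> (\<Union>\<psi>\<in>D. theta_dia n \<psi>))"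
    using 5 by (simp add: Supp2_def)
  show "\<forall>I J. I \<subseteq> Theta n \<and> J \<subseteq> Theta n \<and> I \<inter> J = {} \<longrightarrow>
      ((\<exists>M :: 'w kripke. S4_model M \<and> \<not> valid_in M (rule_IJ I J)) \<longleftrightarrow>
       (\<exists>W\<in>Supp1 n. W \<inter> I \<noteq> {} \<and> W \<subseteq> I \<union> J))"
    by (intro allI impI, elim conjE) (simp only: invalid_iff[OF assms(2)] invalidates_disjoint)
  show "\<forall>I J. I \<subseteq> Theta n \<and> J \<subseteq> Theta n \<and> I \<inter> J = {} \<longrightarrow>
      (\<not> admissible (rule_IJ I J) \<longleftrightarrow> (\<exists>W\<in>Supp2 n. W \<inter> I \<noteq> {} \<and> W \<subseteq> I \<union> J))"
    by (intro allI impI, elim conjE) (simp only: inadmissible_iff invalidates_disjoint)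
  show "\<forall>I J. I \<subseteq> Theta n \<and> J \<subseteq> Theta n \<longrightarrow>
      (\<forall>M :: 'w kripke. S4_model M \<longrightarrow> valid_in M (rule_IJ I J)) \<longrightarrow> admissible (rule_IJ I J)"
  proof (intro allI impI, elim conjE)
    fix I J assume IJ: "I \<subseteq> Theta n" "J \<subseteq> Theta n"
      and "\<forall>M :: 'w kripke. S4_model M \<longrightarrow> valid_in M (rule_IJ I J)"
    then have "\<not> (\<exists>W\<in>Supp1 n. invalidates W I J)"
      unfolding invalid_iff[OF assms(2) IJ, symmetric] by blast
    \<comment> \<open>\<open>Supp2 n\<close> is a subfamily of \<open>Supp1 n\<close>.\<close>
    then have "\<not> (\<exists>W\<in>Supp2 n. invalidates W I J)" by (auto simp: Supp2_def)
    then show "admissible (rule_IJ I J)" unfolding inadmissible_iff[OF IJ, symmetric] by blast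
  qed
  show "\<forall>I J. I \<subseteq> Theta n \<and> J \<subseteq> Theta n \<longrightarrow>
      (\<exists>M :: 'w kripke. S4_model M \<and> \<not> valid_in M (rule_IJ I J)) \<longrightarrow>
      (\<exists>x\<in>Theta n. theta n x = theta_dia n x \<and> \<not> admissible (rule_xIJ x I J))"
  proof (intro allI impI, elim conjE)
    fix I J assume IJ: "I \<subseteq> Theta n" "J \<subseteq> Theta n"
      and "\<exists>M :: 'w kripke. S4_model M \<and> \<not> valid_in M (rule_IJ I J)"
    then obtain W where "W \<in> Supp1 n" "invalidates W I J"
      unfolding invalid_iff[OF assms(2) IJ] by blast
    with assms(1) IJ show "\<exists>x\<in>Theta n. theta n x = theta_dia n x \<and> \<not> admissible (rule_xIJ x I J)"
      by (rule invalid_imp_inadmissible_insert)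
  qed
  show "\<forall>(k::nat) I J. (\<forall>i\<in>{1..k}. I i \<subseteq> Theta n \<and> J i \<subseteq> Theta n \<and> I i \<inter> J i = {}) \<longrightarrow>
      ((\<exists>M :: 'w kripke. S4_model M \<and> (\<forall>i\<in>{1..k}. \<not> valid_in M (rule_IJ (I i) (J i)))) \<longleftrightarrow>
       (\<exists>W\<in>Supp1 n. \<forall>i\<in>{1..k}. W \<inter> I i \<noteq> {} \<and> W \<subseteq> I i \<union> J i))"
  proof (intro allI impI)
    fix k :: nat and I J :: "nat \<Rightarrow> fm set"
    assume *: "\<forall>i\<in>{1..k}. I i \<subseteq> Theta n \<and> J i \<subseteq> Theta n \<and> I i \<inter> J i = {}"
    then have "(\<forall>i\<in>{1..k}. invalidates W (I i) (J i)) \<longleftrightarrow>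
        (\<forall>i\<in>{1..k}. W \<inter> I i \<noteq> {} \<and> W \<subseteq> I i \<union> J i)" for W
      using invalidates_disjoint by (intro ball_cong) auto
    then show "(\<exists>M :: 'w kripke. S4_model M \<and> (\<forall>i\<in>{1..k}. \<not> valid_in M (rule_IJ (I i) (J i)))) \<longleftrightarrow>
        (\<exists>W\<in>Supp1 n. \<forall>i\<in>{1..k}. W \<inter> I i \<noteq> {} \<and> W \<subseteq> I i \<union> J i)"
      using simultaneously_invalid_iff[OF assms(2), of "{1..k}" I n J] * by simp
  qed
  show "\<forall>(k::nat) I J. (\<forall>i\<in>{1..k}. I i \<subseteq> Theta n \<and> J i \<subseteq> Theta n \<and> I i \<inter> J i = {}) \<longrightarrow>
      ((\<exists>\<sigma>. \<forall>i\<in>{1..k}. rejects \<sigma> (rule_IJ (I i) (J i))) \<longleftrightarrow>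
       (\<exists>W\<in>Supp2 n. \<forall>i\<in>{1..k}. W \<inter> I i \<noteq> {} \<and> W \<subseteq> I i \<union> J i))"
  proof (intro allI impI)
    fix k :: nat and I J :: "nat \<Rightarrow> fm set"
    assume *: "\<forall>i\<in>{1..k}. I i \<subseteq> Theta n \<and> J i \<subseteq> Theta n \<and> I i \<inter> J i = {}"
    then have "(\<forall>i\<in>{1..k}. invalidates W (I i) (J i)) \<longleftrightarrow>
        (\<forall>i\<in>{1..k}. W \<inter> I i \<noteq> {} \<and> W \<subseteq> I i \<union> J i)" for W
      using invalidates_disjoint by (intro ball_cong) auto
    then show "(\<exists>\<sigma>. \<forall>i\<in>{1..k}. rejects \<sigma> (rule_IJ (I i) (J i))) \<longleftrightarrow>
        (\<exists>W\<in>Supp2 n. \<forall>i\<in>{1..k}. W \<inter> I i \<noteq> {} \<and> W \<subseteq> I i \<union> J i)"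
      using simultaneously_rejected_iff[of "{1..k}" I n J] * by simp
  qed
  show "\<forall>(k::nat) I J. (\<forall>i\<in>{1..k}. I i \<subseteq> Theta n \<and> J i \<subseteq> Theta n) \<and>
      (\<exists>x\<in>Theta n. theta n x = theta_dia n x \<and>
         (\<forall>i\<in>{1..k}. {y \<in> I i - J i. theta n y = theta_dia n y} \<noteq> {x})) \<longrightarrow>
      (\<exists>M :: 'w kripke. S4_model M \<and> (\<forall>i\<in>{1..k}. \<not> valid_in M (rule_IJ (I i) (J i)))) \<longrightarrow>
      (\<exists>x\<in>Theta n. theta n x = theta_dia n x \<and>
         (\<exists>\<sigma>. \<forall>i\<in>{1..k}. rejects \<sigma> (rule_xIJ x (I i) (J i))))"
  proof (intro allI impI, elim conjE bexE)
    fix k :: nat and I J :: "nat \<Rightarrow> fm set" and x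
    assume "\<forall>i\<in>{1..k}. I i \<subseteq> Theta n \<and> J i \<subseteq> Theta n"
      and x: "x \<in> Theta n" "theta n x = theta_dia n x"
        "\<forall>i\<in>{1..k}. {y \<in> I i - J i. theta n y = theta_dia n y} \<noteq> {x}"
      and invalid: "\<exists>M :: 'w kripke. S4_model M \<and> (\<forall>i\<in>{1..k}. \<not> valid_in M (rule_IJ (I i) (J i)))"
    then have IJ: "I i \<subseteq> Theta n \<and> J i \<subseteq> Theta n" if "i \<in> {1..k}" for i
      using that by blast
    have "\<exists>W\<in>Supp1 n. \<forall>i\<in>{1..k}. invalidates W (I i) (J i)"
      using invalid simultaneously_invalid_iff[OF assms(2), of "{1..k}" I n J] IJ by simp
    then obtain W where W: "W \<in> Supp1 n" "\<forall>i\<in>{1..k}. invalidates W (I i) (J i)"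
      by blast
    show "\<exists>x\<in>Theta n. theta n x = theta_dia n x \<and>
        (\<exists>\<sigma>. \<forall>i\<in>{1..k}. rejects \<sigma> (rule_xIJ x (I i) (J i)))"
      by (rule simultaneously_rejected_insert[OF _ x(1,2) _ W(1)])
        (erule IJ bspec[OF x(3)] bspec[OF W(2)])+
  qed
qed

end
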